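(* Suppose $\{\lambda_n\}_{n\ge1}\subset\mathbb{D}$ is an interpolating sequence, and $\{w_{n}\}_{n\ge1}$ and $\{w_{n}'\}_{n\ge1}$ are bounded sequences of nonzero complex numbers for which there are constants $m, M$ with $$0 < m \leq \Big|\frac{w_{n}'}{w_n}\Big| \leq M < \infty, \quad n \geq 1.$$ Then: (a) there is an outer function $\phi$ with $\phi(\lambda_n)=w_n$ for all $n$ if and only if there is an outer function $\phi'$ with $\phi'(\lambda_n)=w_n'$ for all $n$; and (b) there is a bounded outer function $\phi$ with $\phi(\lambda_n)=w_n$ for all $n$ if and only if there is a bounded outer function $\phi'$ with $\phi'(\lambda_n)=w_n'$ for all $n$.
   Context: $\mathbb{D}$ is the open unit disk in $\mathbb{C}$, $\mathbb{T}$ the unit circle, and integration on $\mathbb{T}$ is with respect to normalized Lebesgue measure, denoted $d\sigma$ here. A sequence $\Lambda=\{\lambda_n\}_{n\ge1}$ of distinct points of $\mathbb{D}$ is interpolating if $\delta(\Lambda) := \inf_{n \geq 1} \prod_{k\ge 1, k \ne n} \left| \frac{\lambda_k-\lambda_n}{1-\overline{\lambda}_k \lambda_n}\right| > 0$. An outer function is an analytic function on $\mathbb{D}$ of the form $\phi(z)=\gamma\exp\big(\int_{\mathbb{T}} \frac{\xi + z}{\xi - z} W(\xi)\, d\sigma(\xi)\big)$, where $\gamma\in\mathbb{C}$, $|\gamma|=1$, and $W$ is an extended real-valued integrable function on $\mathbb{T}$. A bounded outer function is an outer function that is bounded on $\mathbb{D}$. *)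

theory Defs
  imports "HOL-Analysis.Analysis"
begin

text \<open>Normalized Lebesgue measure on the unit circle. The completion makes the measurable sets the
  Lebesgue (not merely Borel) measurable subsets of the circle.\<close>

definition circle_measure :: "complex measure" where
  "circle_measure =
     completion (distr (uniform_measure lborel {0..2 * pi}) (restrict_space borel (sphere 0 1)) cis)"

definition integrable_on_circle :: "(complex \<Rightarrow> ereal) \<Rightarrow> bool" where
  "integrable_on_circle W \<longleftrightarrow>
     W \<in> borel_measurable circle_measure \<and>
     (\<integral>\<^sup>+ \<xi>. e2ennreal \<bar>W \<xi>\<bar> \<partial>circle_measure) < \<infinity>"

text \<open>The infinite product is the limit of its partial products. These are decreasing and
  nonnegative, so the limit exists. The library's \<^const>\<open>prodinf\<close> is not suitable: it takes
  no value when the partial products of nonzero factors tend to 0, where the product has to be 0.\<close>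

definition separation_constant :: "(nat \<Rightarrow> complex) \<Rightarrow> real" where
  "separation_constant \<Lambda> =
     (INF n. lim (\<lambda>N. \<Prod>k\<in>{..<N} - {n}. cmod ((\<Lambda> k - \<Lambda> n) / (1 - cnj (\<Lambda> k) * \<Lambda> n))))"

definition interpolating_sequence :: "(nat \<Rightarrow> complex) \<Rightarrow> bool" where
  "interpolating_sequence \<Lambda> \<longleftrightarrow>
     inj \<Lambda> \<and> range \<Lambda> \<subseteq> ball 0 1 \<and> separation_constant \<Lambda> > 0"

text \<open>Functions on the disk are total functions whose values outside the disk are irrelevant.
  An integrable \<open>W\<close> is finite almost everywhere, so it does not matter that \<^const>\<open>real_of_ereal\<close>
  sends the infinite values to 0.\<close>

definition outer_function :: "(complex \<Rightarrow> complex) \<Rightarrow> bool" where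
  "outer_function \<phi> \<longleftrightarrow>
     \<phi> holomorphic_on ball 0 1 \<and>
     (\<exists>\<gamma> W. cmod \<gamma> = 1 \<and> integrable_on_circle W \<and>
       (\<forall>z\<in>ball 0 1. \<phi> z =
          \<gamma> * exp (\<integral>\<xi>. (\<xi> + z) / (\<xi> - z) * of_real (real_of_ereal (W \<xi>)) \<partial>circle_measure)))"

definition bounded_outer_function :: "(complex \<Rightarrow> complex) \<Rightarrow> bool" where
  "bounded_outer_function \<phi> \<longleftrightarrow> outer_function \<phi> \<and> bounded (\<phi> ` ball 0 1)"

end

theory Submission
  imports Defs "HOL-Complex_Analysis.Complex_Analysis"
begin

text \<open>The quotients \<open>w' n / w n\<close> have bounded logarithms, so by Carleson's theorem some bounded
  holomorphic \<open>f\<close> on the disk takes these logarithms as values at the points \<open>\<Lambda> n\<close>. Since \<open>Re f\<close> is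
  the Poisson integral of a bounded function, \<open>exp f\<close> is an outer function, bounded above and away
  from 0, and multiplication by \<open>exp f\<close> turns a solution for \<open>w\<close> into one for \<open>w'\<close>.

  Carleson's theorem is obtained from Peter Jones' explicit interpolating functions for finitely many
  nodes, whose bounds depend only on the separation constant, and Montel's theorem. The boundary
  function of a bounded holomorphic \<open>f\<close> is an almost everywhere limit of dilations \<open>f (r * \<xi>)\<close>
  with \<open>r \<rightarrow> 1\<close>, which are Cauchy in \<open>L\<^sup>2\<close> by Parseval's identity.\<close>

subsection \<open>Integration over the unit circle\<close>

text \<open>The measure before completion. Continuous functions are Borel measurable for it, and
  completing changes neither their measurability nor their integrals.\<close>

abbreviation (input) circle_base :: "complex measure" where
  "circle_base \<equiv> distr (uniform_measure lborel {0..2 * pi}) (restrict_space borel (sphere 0 1)) cis"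

lemma cis_measurable_sphere:
  "cis \<in> uniform_measure lborel {0..2 * pi} \<rightarrow>\<^sub>M restrict_space borel (sphere 0 1)"
proof (rule measurable_restrict_space2)
  have "cis \<in> borel_measurable borel"
    by (rule borel_measurable_continuous_onI) (intro continuous_intros)
  thus "cis \<in> uniform_measure lborel {0..2 * pi} \<rightarrow>\<^sub>M borel"
    by (simp add: uniform_measure_def)
qed auto

lemma space_circle_measure [simp]: "space circle_measure = sphere 0 1"
  by (simp add: circle_measure_def space_restrict_space)

lemma finite_measure_circle: "finite_measure circle_measure"
proof
  have "emeasure circle_measure (space circle_measure) = emeasure circle_base (space circle_base)"
    unfolding circle_measure_def space_completion
    by (subst emeasure_completion[OF sets_completionI_sets[OF sets.top]])
       (simp only: main_part[OF sets.top])
  also have "\<dots> = emeasure (uniform_measure lborel {0..2 * pi})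
     (cis -` space circle_base \<inter> space (uniform_measure lborel {0..2*pi}))"
    by (rule emeasure_distr[OF cis_measurable_sphere])
       (simp only: space_distr sets.top)
  also have "cis -` space circle_base \<inter> space (uniform_measure lborel {0..2*pi}) = UNIV"
    by (auto simp: space_restrict_space)
  also have "emeasure (uniform_measure lborel {0..2 * pi}) UNIV \<noteq> \<infinity>"
    by (simp add: ennreal_divide_eq_top_iff)
  finally show "emeasure circle_measure (space circle_measure) \<noteq> \<infinity>" .
qed

lemma borel_measurable_circle_base:
  fixes f :: "complex \<Rightarrow> 'b::topological_space"
  assumes "continuous_on (sphere 0 1) f"
  shows "f \<in> borel_measurable circle_base"
  using borel_measurable_continuous_on_restrict[OF assms] by simp

lemma borel_measurable_circle:
  fixes f :: "complex \<Rightarrow> 'b::topological_space"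
  assumes "continuous_on (sphere 0 1) f"
  shows "f \<in> borel_measurable circle_measure"
  unfolding circle_measure_def
  by (rule measurable_completion) (rule borel_measurable_circle_base[OF assms])

lemma integrable_circle_bounded:
  fixes f :: "complex \<Rightarrow> 'b::{banach, second_countable_topology}"
  assumes "f \<in> borel_measurable circle_measure" "\<And>\<xi>. \<xi> \<in> sphere 0 1 \<Longrightarrow> norm (f \<xi>) \<le> B"
  shows "integrable circle_measure f"
  using assms by (intro finite_measure.integrable_const_bound[OF finite_measure_circle, where B=B]) auto

lemma integrable_circle_continuous:
  fixes f :: "complex \<Rightarrow> 'b::{banach, second_countable_topology}"
  assumes "continuous_on (sphere 0 1) f"
  shows "integrable circle_measure f"
proof -
  have "bounded (f ` sphere 0 1)"
    by (intro compact_imp_bounded compact_continuous_image assms) simp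
  then obtain B where "\<And>\<xi>. \<xi> \<in> sphere 0 1 \<Longrightarrow> norm (f \<xi>) \<le> B"
    unfolding bounded_iff by blast
  thus ?thesis
    by (intro integrable_circle_bounded borel_measurable_circle assms)
qed

text \<open>Passes to the gauge integral over \<open>{0..2*pi}\<close>, the form in which contour
  integrals along a circle are given. Continuity makes the integrand Borel, as needed to move it
  through the completion and the image measure.\<close>

lemma integral_circle_eq_integral_cis:
  fixes f :: "complex \<Rightarrow> complex"
  assumes f: "continuous_on (sphere 0 1) f"
  shows "(\<integral>\<xi>. f \<xi> \<partial>circle_measure) = integral {0..2*pi} (\<lambda>t. f (cis t)) / (2 * pi)"
proof -
  have c: "continuous_on UNIV (\<lambda>t. f (cis t))"
    by (rule continuous_on_compose2[OF f]) (auto intro!: continuous_intros)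
  have m: "(\<lambda>t. f (cis t)) \<in> borel_measurable borel"
    by (rule borel_measurable_continuous_onI[OF c])
  have "(\<integral>\<xi>. f \<xi> \<partial>circle_measure) = (\<integral>\<xi>. f \<xi> \<partial>circle_base)"
    unfolding circle_measure_def
    by (rule integral_completion) (rule borel_measurable_circle_base[OF f])
  also have "\<dots> = (\<integral>t. f (cis t) \<partial>uniform_measure lborel {0..2*pi})"
    by (rule integral_distr[OF cis_measurable_sphere borel_measurable_continuous_on_restrict[OF f]])
  also have "uniform_measure lborel {0..2*pi} =
      density lborel (\<lambda>t. ennreal (indicator {0..2*pi} t / (2*pi)))"
    unfolding uniform_measure_def
    by (intro arg_cong[where f="density lborel"] ext)
       (auto simp: divide_ennreal[symmetric] split: split_indicator)
  also have "(\<integral>t. f (cis t) \<partial>\<dots>) = (\<integral>t. (indicator {0..2*pi} t / (2*pi)) *\<^sub>R f (cis t) \<partial>lborel)"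
    using m by (intro integral_density) auto
  also have "\<dots> = (\<integral>t. (indicator {0..2*pi} t *\<^sub>R f (cis t)) / (2*pi) \<partial>lborel)"
    by (intro Bochner_Integration.integral_cong) (auto simp: scaleR_conv_of_real)
  also have "\<dots> = (LINT t:{0..2*pi}|lborel. f (cis t)) / (2*pi)"
    unfolding set_lebesgue_integral_def by simp
  also have "(LINT t:{0..2*pi}|lborel. f (cis t)) = integral {0..2*pi} (\<lambda>t. f (cis t))"
    by (intro set_borel_integral_eq_integral borel_integrable_atLeastAtMost'
        continuous_on_subset[OF c]) auto
  finally show ?thesis .
qed

section \<open>Cauchy's formulas and the Schwarz formula on the circle\<close>

text \<open>Along \<open>\<xi> = cis t\<close> the contour differential is
  \<open>\<i> * \<xi> * dt\<close>, so the factor \<open>\<xi>\<close> converts arc length into it;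
  \<open>2 * pi\<close> is the normalization.\<close>

lemma integral_circle_has_contour_integral:
  assumes "continuous_on (sphere 0 1) f" and I: "(f has_contour_integral I) (circlepath 0 1)"
  shows "(\<integral>\<xi>. \<xi> * f \<xi> \<partial>circle_measure) = I / (2 * pi * \<i>)"
proof -
  have "((\<lambda>t. f (cis t) * \<i> * cis t) has_integral I) {0..2*pi}"
    using I has_contour_integral_part_circlepath_iff[of 0 "2*pi" f I 0 1]
    by (simp add: circlepath_def)
  hence "((\<lambda>t. (1/\<i>) * (f (cis t) * \<i> * cis t)) has_integral (1/\<i>) * I) {0..2*pi}"
    by (rule has_integral_mult_right)
  hence "((\<lambda>t. cis t * f (cis t)) has_integral (1/\<i>) * I) {0..2*pi}"
    by (simp add: field_simps)
  hence "integral {0..2*pi} (\<lambda>t. cis t * f (cis t)) = (1/\<i>) * I"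
    by (rule integral_unique)
  moreover have "(\<integral>\<xi>. \<xi> * f \<xi> \<partial>circle_measure)
      = integral {0..2*pi} (\<lambda>t. cis t * f (cis t)) / (2 * pi)"
    by (rule integral_circle_eq_integral_cis) (intro continuous_intros assms)
  ultimately show ?thesis by (simp add: field_simps)
qed

text \<open>A radius \<open>R > 1\<close> puts the closed unit disk inside the domain; dilations of
  functions on the unit disk have this property.\<close>

lemma integral_circle_Cauchy:
  assumes f: "f holomorphic_on ball 0 R" "1 < R" and z: "cmod z < 1"
  shows "(\<integral>\<xi>. \<xi> / (\<xi> - z) * f \<xi> \<partial>circle_measure) = f z"
proof -
  have sub: "cball 0 1 \<subseteq> ball (0::complex) R" "sphere 0 1 \<subseteq> ball (0::complex) R"
    using f(2) by auto
  have cf: "continuous_on (cball 0 1) f" "continuous_on (sphere 0 1) f"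
    using holomorphic_on_imp_continuous_on[OF f(1)] sub continuous_on_subset by blast+
  have "((\<lambda>u. f u / (u - z)) has_contour_integral (2 * of_real pi * \<i> * f z)) (circlepath 0 1)"
    using z f(2) cf(1) by (intro Cauchy_integral_circlepath holomorphic_on_subset[OF f(1)]) auto
  moreover have "continuous_on (sphere 0 1) (\<lambda>u. f u / (u - z))"
    using z by (intro continuous_intros cf) auto
  ultimately have "(\<integral>\<xi>. \<xi> * (f \<xi> / (\<xi> - z)) \<partial>circle_measure) = 2 * of_real pi * \<i> * f z / (2 * pi * \<i>)"
    by (rule integral_circle_has_contour_integral[rotated])
  thus ?thesis by simp
qed

lemma integral_circle_mean_value:
  assumes "f holomorphic_on ball 0 R" "1 < R"
  shows "(\<integral>\<xi>. f \<xi> \<partial>circle_measure) = f 0"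
proof -
  have "(\<integral>\<xi>. f \<xi> \<partial>circle_measure) = (\<integral>\<xi>. \<xi> / (\<xi> - 0) * f \<xi> \<partial>circle_measure)"
    by (rule Bochner_Integration.integral_cong) auto
  thus ?thesis using integral_circle_Cauchy[OF assms, of 0] by simp
qed

text \<open>On the circle \<open>cnj \<xi>\<close> is \<open>1 / \<xi>\<close>, so this is Cauchy's
  formula for the derivatives at 0.\<close>

lemma integral_circle_coeff:
  assumes f: "f holomorphic_on ball 0 R" "1 < R"
  shows "(\<integral>\<xi>. cnj \<xi> ^ n * f \<xi> \<partial>circle_measure) = (deriv ^^ n) f 0 / fact n"
proof -
  have sub: "cball 0 1 \<subseteq> ball (0::complex) R" "sphere 0 1 \<subseteq> ball (0::complex) R"
    using f(2) by auto
  have cf: "continuous_on (cball 0 1) f" "continuous_on (sphere 0 1) f"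
    using holomorphic_on_imp_continuous_on[OF f(1)] sub continuous_on_subset by blast+
  have "((\<lambda>u. f u / (u - 0) ^ Suc n) has_contour_integral
      (2 * pi * \<i> / fact n * (deriv ^^ n) f 0)) (circlepath 0 1)"
    using f(2) cf(1)
    by (intro Cauchy_has_contour_integral_higher_derivative_circlepath
        holomorphic_on_subset[OF f(1)]) auto
  moreover have "continuous_on (sphere 0 1) (\<lambda>u. f u / (u - 0) ^ Suc n)"
    by (intro continuous_intros cf) auto
  ultimately have *: "(\<integral>\<xi>. \<xi> * (f \<xi> / (\<xi> - 0) ^ Suc n) \<partial>circle_measure)
      = 2 * pi * \<i> / fact n * (deriv ^^ n) f 0 / (2 * pi * \<i>)"
    by (rule integral_circle_has_contour_integral[rotated])
  have "(\<integral>\<xi>. cnj \<xi> ^ n * f \<xi> \<partial>circle_measure) = (\<integral>\<xi>. \<xi> * (f \<xi> / (\<xi> - 0) ^ Suc n) \<partial>circle_measure)"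
  proof (rule Bochner_Integration.integral_cong)
    fix \<xi> assume "\<xi> \<in> space circle_measure"
    hence "cmod \<xi> = 1" by simp
    hence c: "cnj \<xi> = inverse \<xi>" "\<xi> \<noteq> 0"
      using divide_conv_cnj[of \<xi> 1] by (auto simp: field_simps)
    show "cnj \<xi> ^ n * f \<xi> = \<xi> * (f \<xi> / (\<xi> - 0) ^ Suc n)"
      unfolding c(1) using c(2) by (simp add: power_inverse field_simps)
  qed simp
  thus ?thesis using * by simp
qed

text \<open>Write \<open>Re (f \<xi>)\<close> as half of \<open>f \<xi> + cnj (f \<xi>)\<close> and
  let \<open>K\<close> be the kernel. Since \<open>(K + 1) / 2\<close> is the Cauchy kernel, the
  part with \<open>f\<close> gives \<open>f z - f 0 / 2\<close>. On the circle \<open>cnj K\<close>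
  is \<open>(1 + cnj z * \<xi>) / (1 - cnj z * \<xi>)\<close>, which extends holomorphically beyond
  the closed disk with value 1 at 0, so the mean value property turns the other part into
  \<open>cnj (f 0) / 2\<close>.\<close>

lemma Schwarz_integral_formula:
  assumes f: "f holomorphic_on ball 0 R" "1 < R" and z: "cmod z < 1"
  shows "(\<integral>\<xi>. (\<xi> + z) / (\<xi> - z) * of_real (Re (f \<xi>)) \<partial>circle_measure) = f z - \<i> * Im (f 0)"
proof -
  have sub: "cball 0 1 \<subseteq> ball (0::complex) R" "sphere 0 1 \<subseteq> ball (0::complex) R"
    using f(2) by auto
  have cf: "continuous_on (sphere 0 1) f"
    using holomorphic_on_imp_continuous_on[OF f(1)] sub continuous_on_subset by blast
  \<comment> \<open>A radius above 1 that does not reach beyond the pole \<open>1 / cnj z\<close>.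
    The maximum with \<open>1/2\<close> covers \<open>z = 0\<close>, where
    \<open>inverse 0 = 0\<close> would be too small.\<close>
  define S where "S = min R (inverse (max (cmod z) (1/2)))"
  have S: "1 < S" "S \<le> R" "cmod z * S \<le> 1"
  proof -
    have "1 < inverse (max (cmod z) (1/2))"
      using z by (intro one_less_inverse) auto
    thus "1 < S" "S \<le> R" using f(2) by (auto simp: S_def)
    have "cmod z * S \<le> max (cmod z) (1/2) * inverse (max (cmod z) (1/2))"
      using f(2) by (intro mult_mono) (auto simp: S_def)
    also have "\<dots> = 1" by (intro right_inverse) auto
    finally show "cmod z * S \<le> 1" .
  qed
  have ne: "1 - cnj z * u \<noteq> 0" if "cmod u < S" for u
  proof
    assume "1 - cnj z * u = 0"
    hence "cnj z * u = 1" by simp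
    hence 1: "cmod z * cmod u = 1" by (metis complex_mod_cnj norm_mult norm_one)
    hence "cmod z > 0" by (metis mult_zero_left norm_ge_zero order_le_less zero_neq_one)
    hence "cmod z * cmod u < cmod z * S" using that by simp
    thus False using S(3) 1 by simp
  qed
  have "(\<lambda>u. f u * ((1 + cnj z * u) / (1 - cnj z * u))) holomorphic_on ball 0 S"
    using S(2) ne by (intro holomorphic_intros holomorphic_on_subset[OF f(1)]) auto
  hence 1: "(\<integral>\<xi>. f \<xi> * ((1 + cnj z * \<xi>) / (1 - cnj z * \<xi>)) \<partial>circle_measure) = f 0"
    using integral_circle_mean_value[OF _ S(1)] by fastforce
  have "(\<integral>\<xi>. cnj (f \<xi>) * ((\<xi> + z) / (\<xi> - z)) \<partial>circle_measure)
      = (\<integral>\<xi>. cnj (f \<xi> * ((1 + cnj z * \<xi>) / (1 - cnj z * \<xi>))) \<partial>circle_measure)"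
  proof (rule Bochner_Integration.integral_cong)
    fix \<xi> assume "\<xi> \<in> space circle_measure"
    hence n: "cmod \<xi> = 1" by simp
    hence c: "cnj \<xi> = inverse \<xi>" "\<xi> \<noteq> 0"
      using divide_conv_cnj[of \<xi> 1] by (auto simp: field_simps)
    have "\<xi> - z \<noteq> 0" using n z by auto
    hence "(1 + z * inverse \<xi>) / (1 - z * inverse \<xi>) = (\<xi> + z) / (\<xi> - z)"
      using c(2) by (simp add: field_simps)
    thus "cnj (f \<xi>) * ((\<xi> + z) / (\<xi> - z)) = cnj (f \<xi> * ((1 + cnj z * \<xi>) / (1 - cnj z * \<xi>)))"
      using c by (simp flip: times_divide_eq_right)
  qed simp
  also have "\<dots> = cnj (f 0)"
    using 1 by (simp only: Bochner_Integration.integral_cnj)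
  finally have 2: "(\<integral>\<xi>. cnj (f \<xi>) * ((\<xi> + z) / (\<xi> - z)) \<partial>circle_measure) = cnj (f 0)" .
  have nz: "\<xi> - z \<noteq> 0" if "\<xi> \<in> sphere 0 1" for \<xi> using that z by auto
  have lin: "(\<integral>\<xi>. a \<xi> - b \<xi> / 2 + c \<xi> / 2 \<partial>circle_measure) =
      (\<integral>\<xi>. a \<xi> \<partial>circle_measure) - (\<integral>\<xi>. b \<xi> \<partial>circle_measure) / 2
      + (\<integral>\<xi>. c \<xi> \<partial>circle_measure) / 2"
    if "integrable circle_measure a" "integrable circle_measure b" "integrable circle_measure c"
    for a b c :: "complex \<Rightarrow> complex"
    using that by simp
  have i1: "integrable circle_measure (\<lambda>\<xi>. \<xi> / (\<xi> - z) * f \<xi>)"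
    and i2: "integrable circle_measure f"
    and i3: "integrable circle_measure (\<lambda>\<xi>. cnj (f \<xi>) * ((\<xi> + z) / (\<xi> - z)))"
    using nz by (intro integrable_circle_continuous continuous_intros cf; force)+
  have "(\<integral>\<xi>. (\<xi> + z) / (\<xi> - z) * of_real (Re (f \<xi>)) \<partial>circle_measure) =
    (\<integral>\<xi>. (\<xi> / (\<xi> - z) * f \<xi>) - f \<xi> / 2 + (cnj (f \<xi>) * ((\<xi> + z) / (\<xi> - z))) / 2 \<partial>circle_measure)"
  proof (rule Bochner_Integration.integral_cong)
    fix \<xi> assume "\<xi> \<in> space circle_measure"
    hence "\<xi> - z \<noteq> 0" using nz by simp
    define K where "K = (\<xi> + z) / (\<xi> - z)"
    have K: "\<xi> / (\<xi> - z) = (K + 1) / 2"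
      using \<open>\<xi> - z \<noteq> 0\<close> unfolding K_def by (simp add: field_simps)
    have "complex_of_real (Re (f \<xi>)) = (f \<xi> + cnj (f \<xi>)) / 2"
      by (simp add: complex_add_cnj)
    thus "(\<xi> + z) / (\<xi> - z) * of_real (Re (f \<xi>)) =
      (\<xi> / (\<xi> - z) * f \<xi>) - f \<xi> / 2 + (cnj (f \<xi>) * ((\<xi> + z) / (\<xi> - z))) / 2"
      unfolding K K_def[symmetric] by (simp add: field_simps)
  qed simp
  also have "\<dots> = f z - f 0 / 2 + cnj (f 0) / 2"
    unfolding lin[OF i1 i2 i3] 2 integral_circle_Cauchy[OF f z] integral_circle_mean_value[OF f] ..
  also have "\<dots> = f z - \<i> * Im (f 0)"
    by (simp add: complex_eq_iff)
  finally show ?thesis .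
qed

subsection \<open>Boundary values of bounded holomorphic functions\<close>

text \<open>Expand \<open>cnj (f \<xi>)\<close> in its power series and integrate
  \<open>cnj (f \<xi>) * f \<xi>\<close> term by term; each integral is a Taylor coefficient by
  \<open>integral_circle_coeff\<close>.\<close>

lemma Parseval_circle:
  assumes f: "f holomorphic_on ball 0 R" "1 < R"
  shows "(\<lambda>n. (cmod ((deriv ^^ n) f 0 / fact n))\<^sup>2) sums (\<integral>\<xi>. (cmod (f \<xi>))\<^sup>2 \<partial>circle_measure)"
proof -
  define c where "c n = (deriv ^^ n) f 0 / fact n" for n
  have ser: "(\<lambda>n. c n * w ^ n) sums f w" if "cmod w < R" for w
    using holomorphic_power_series[OF f(1), of w] that by (simp add: c_def)
  have cf: "continuous_on (sphere 0 1) f"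
    using f(2) by (intro continuous_on_subset[OF holomorphic_on_imp_continuous_on[OF f(1)]]) auto
  \<comment> \<open>Convergence at a point beyond 1 makes the coefficients absolutely summable,
    which justifies exchanging sum and integral.\<close>
  obtain r where r: "1 < r" "r < R" using dense[OF f(2)] by blast
  have "summable (\<lambda>n. c n * complex_of_real r ^ n)"
    using ser[of "of_real r"] r by (auto simp: sums_iff)
  hence "summable (\<lambda>n. norm (c n * 1 ^ n))"
    by (rule powser_insidea) (use r in auto)
  hence sum_c: "summable (\<lambda>n. cmod (c n))" by simp
  define g where "g n \<xi> = cnj (c n) * (cnj \<xi> ^ n * f \<xi>)" for n \<xi>
  have ci: "continuous_on (sphere 0 1) (\<lambda>\<xi>. cnj \<xi> ^ n * f \<xi>)" for n
    by (intro continuous_intros cf)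
  have ig: "integrable circle_measure (g n)" for n
    unfolding g_def by (intro integrable_mult_right integrable_circle_continuous ci)
  have ng: "norm (g n \<xi>) = cmod (c n) * cmod (f \<xi>)" if "\<xi> \<in> space circle_measure" for n \<xi>
    using that by (simp add: g_def norm_mult norm_power)
  have "(\<lambda>n. \<integral>\<xi>. g n \<xi> \<partial>circle_measure) sums (\<integral>\<xi>. (\<Sum>n. g n \<xi>) \<partial>circle_measure)"
  proof (rule sums_integral)
    show "AE \<xi> in circle_measure. summable (\<lambda>n. norm (g n \<xi>))"
    proof (rule AE_I2)
      fix \<xi> assume "\<xi> \<in> space circle_measure"
      thus "summable (\<lambda>n. norm (g n \<xi>))"
        using ng summable_mult2[OF sum_c] by simp
    qed
    have "(\<integral>\<xi>. norm (g n \<xi>) \<partial>circle_measure) = cmod (c n) * (\<integral>\<xi>. cmod (f \<xi>) \<partial>circle_measure)" for n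
    proof -
      have "(\<integral>\<xi>. norm (g n \<xi>) \<partial>circle_measure) = (\<integral>\<xi>. cmod (c n) * cmod (f \<xi>) \<partial>circle_measure)"
        by (rule Bochner_Integration.integral_cong) (auto simp: ng)
      thus ?thesis by simp
    qed
    thus "summable (\<lambda>n. \<integral>\<xi>. norm (g n \<xi>) \<partial>circle_measure)"
      using summable_mult2[OF sum_c] by simp
  qed (rule ig)
  also have "(\<lambda>n. \<integral>\<xi>. g n \<xi> \<partial>circle_measure) = (\<lambda>n. of_real ((cmod (c n))\<^sup>2))"
  proof
    fix n
    have "(\<integral>\<xi>. g n \<xi> \<partial>circle_measure) = cnj (c n) * c n"
      unfolding g_def using integral_circle_coeff[OF f, of n] by (simp add: c_def)
    thus "(\<integral>\<xi>. g n \<xi> \<partial>circle_measure) = of_real ((cmod (c n))\<^sup>2)"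
      by (simp only: complex_norm_square mult.commute)
  qed
  also have "(\<integral>\<xi>. (\<Sum>n. g n \<xi>) \<partial>circle_measure) = (\<integral>\<xi>. of_real ((cmod (f \<xi>))\<^sup>2) \<partial>circle_measure)"
  proof (rule Bochner_Integration.integral_cong)
    fix \<xi> assume "\<xi> \<in> space circle_measure"
    hence "(\<lambda>n. cnj (c n * \<xi> ^ n)) sums cnj (f \<xi>)"
      using ser[of \<xi>] f(2) by (intro sums_cnj[THEN iffD2]) auto
    from sums_mult2[OF this, of "f \<xi>"] have "(\<lambda>n. g n \<xi>) sums (cnj (f \<xi>) * f \<xi>)"
      by (simp add: g_def mult_ac)
    thus "(\<Sum>n. g n \<xi>) = of_real ((cmod (f \<xi>))\<^sup>2)"
      by (simp only: sums_iff complex_norm_square mult.commute)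
  qed simp
  also have "\<dots> = of_real (\<integral>\<xi>. (cmod (f \<xi>))\<^sup>2 \<partial>circle_measure)"
    by (rule integral_complex_of_real)
  finally show ?thesis
    unfolding sums_of_real_iff c_def .
qed

lemma measure_circle: "measure circle_measure (sphere 0 1) = 1"
proof -
  have "(\<integral>\<xi>. 1 \<partial>circle_measure) = (1 :: complex)"
    by (rule integral_circle_mean_value[of _ 2]) auto
  thus ?thesis by (simp add: scaleR_conv_of_real)
qed

lemma holomorphic_dilation:
  assumes f: "f holomorphic_on ball 0 1" and r: "0 < r" "r < 1"
  shows "(\<lambda>z. f (of_real r * z)) holomorphic_on ball 0 (1 / r)"
proof -
  have "(f \<circ> (\<lambda>z. of_real r * z)) holomorphic_on ball 0 (1 / r)"
    using r by (intro holomorphic_on_compose_gen[OF _ f] holomorphic_intros)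
      (auto simp: norm_mult field_simps)
  thus ?thesis by (simp add: o_def)
qed

lemma higher_deriv_dilation:
  assumes f: "f holomorphic_on ball 0 1" and r: "0 < r" "r < 1"
  shows "(deriv ^^ n) (\<lambda>z. f (of_real r * z)) 0 = of_real r ^ n * (deriv ^^ n) f 0"
  using higher_deriv_compose_linear[OF f, of "ball 0 (1 / r)" 0 "of_real r" n] r
  by (auto simp: norm_mult field_simps)

lemma Parseval_dilation:
  assumes f: "f holomorphic_on ball 0 1" and r: "0 < r" "r < 1"
  shows "(\<lambda>n. (cmod ((deriv ^^ n) f 0 / fact n))\<^sup>2 * (r ^ n)\<^sup>2)
     sums (\<integral>\<xi>. (cmod (f (of_real r * \<xi>)))\<^sup>2 \<partial>circle_measure)"
proof -
  have "(cmod ((deriv ^^ n) (\<lambda>z. f (of_real r * z)) 0 / fact n))\<^sup>2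
      = (cmod ((deriv ^^ n) f 0 / fact n))\<^sup>2 * (r ^ n)\<^sup>2" for n
    using r by (simp add: higher_deriv_dilation[OF assms] norm_mult norm_divide norm_power
      power_mult_distrib power_divide)
  thus ?thesis
    using Parseval_circle[OF holomorphic_dilation[OF assms]] r by simp
qed

text \<open>The \<open>n\<close>-th Taylor coefficient of the difference is that of \<open>f\<close>
  times \<open>r ^ n - s ^ n\<close>; both dilations are holomorphic on the smaller of the two
  enlarged disks.\<close>

lemma Parseval_dilation_diff:
  assumes f: "f holomorphic_on ball 0 1" and r: "0 < r" "r < 1" and s: "0 < s" "s < 1"
  shows "(\<lambda>n. (cmod ((deriv ^^ n) f 0 / fact n))\<^sup>2 * (r ^ n - s ^ n)\<^sup>2)
     sums (\<integral>\<xi>. (cmod (f (of_real r * \<xi>) - f (of_real s * \<xi>)))\<^sup>2 \<partial>circle_measure)"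
proof -
  define R where "R = min (1 / r) (1 / s)"
  have R: "1 < R" using r s by (auto simp: R_def)
  have h: "(\<lambda>z. f (of_real r * z)) holomorphic_on ball 0 R" "(\<lambda>z. f (of_real s * z)) holomorphic_on ball 0 R"
    by (rule holomorphic_on_subset[OF holomorphic_dilation[OF f]], use r s in \<open>auto simp: R_def\<close>)+
  have "(deriv ^^ n) (\<lambda>z. f (of_real r * z) - f (of_real s * z)) 0
      = of_real (r ^ n - s ^ n) * (deriv ^^ n) f 0" for n
    using higher_deriv_diff[OF h, of 0 n] R r s
    by (simp add: higher_deriv_dilation[OF f] left_diff_distrib)
  moreover have "(\<lambda>z. f (of_real r * z) - f (of_real s * z)) holomorphic_on ball 0 R"
    by (intro holomorphic_intros h)
  moreover have "(cmod (of_real (r ^ n - s ^ n) * (deriv ^^ n) f 0 / fact n))\<^sup>2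
      = (cmod ((deriv ^^ n) f 0 / fact n))\<^sup>2 * (r ^ n - s ^ n)\<^sup>2" for n
    unfolding norm_mult norm_divide norm_of_real power_mult_distrib power_divide power2_abs by simp
  ultimately show ?thesis
    using Parseval_circle[of "\<lambda>z. f (of_real r * z) - f (of_real s * z)" R] R
    by (simp del: of_real_diff)
qed

text \<open>Parseval bounds every partial sum weighted by \<open>(r ^ n)\<^sup>2\<close> by
  \<open>B\<^sup>2\<close>. A finite sum is continuous in \<open>r\<close>, so letting
  \<open>r\<close> tend to 1 removes the weights.\<close>

lemma summable_coeff_square_bounded_holomorphic:
  assumes f: "f holomorphic_on ball 0 1" and B: "\<And>z. cmod z < 1 \<Longrightarrow> cmod (f z) \<le> B"
  shows "summable (\<lambda>n. (cmod ((deriv ^^ n) f 0 / fact n))\<^sup>2)"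
proof (rule summableI_nonneg_bounded)
  fix N
  define q where "q n = (cmod ((deriv ^^ n) f 0 / fact n))\<^sup>2" for n
  have le: "(\<Sum>n<N. q n * (r ^ n)\<^sup>2) \<le> B\<^sup>2" if r: "0 < r" "r < 1" for r
  proof -
    have S: "(\<lambda>n. q n * (r ^ n)\<^sup>2) sums (\<integral>\<xi>. (cmod (f (of_real r * \<xi>)))\<^sup>2 \<partial>circle_measure)"
      unfolding q_def by (rule Parseval_dilation[OF f r])
    have cont: "continuous_on (sphere 0 1) (\<lambda>z. f (of_real r * z))"
      using r by (intro continuous_on_subset[OF holomorphic_on_imp_continuous_on[OF holomorphic_dilation[OF f r]]])
        (auto simp: field_simps)
    have "(\<Sum>n<N. q n * (r ^ n)\<^sup>2) \<le> (\<integral>\<xi>. (cmod (f (of_real r * \<xi>)))\<^sup>2 \<partial>circle_measure)"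
      by (subst sums_unique[OF S], rule sum_le_suminf) (use S in \<open>auto simp: sums_iff q_def\<close>)
    also have "\<dots> \<le> (\<integral>\<xi>. B\<^sup>2 \<partial>circle_measure)"
    proof (rule integral_mono)
      fix \<xi> assume "\<xi> \<in> space circle_measure"
      thus "(cmod (f (of_real r * \<xi>)))\<^sup>2 \<le> B\<^sup>2"
        using r by (intro power_mono B) (auto simp: norm_mult)
    qed (intro integrable_circle_continuous continuous_intros cont)+
    also have "\<dots> = B\<^sup>2" by (simp add: measure_circle)
    finally show ?thesis .
  qed
  have "((\<lambda>r. \<Sum>n<N. q n * (r ^ n)\<^sup>2) \<longlongrightarrow> (\<Sum>n<N. q n * (1 ^ n)\<^sup>2)) (at_left (1::real))"
    by (intro tendsto_intros)
  moreover have "eventually (\<lambda>r. (\<Sum>n<N. q n * (r ^ n)\<^sup>2) \<le> B\<^sup>2) (at_left (1::real))"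
    using eventually_at_left_real[of 0 "1::real"] by (auto elim!: eventually_mono intro: le)
  ultimately have "(\<Sum>n<N. q n * (1 ^ n)\<^sup>2) \<le> B\<^sup>2"
    by (rule tendsto_upperbound) auto
  thus "(\<Sum>n<N. (cmod ((deriv ^^ n) f 0 / fact n))\<^sup>2) \<le> B\<^sup>2"
    by (simp add: q_def)
qed auto

text \<open>Fix \<open>N\<close> so that the first \<open>N\<close> terms come within
  \<open>\<epsilon>\<close> of the full sum, then \<open>x\<close> so close to 1 that the first
  \<open>N\<close> terms weighted by \<open>x ^ n\<close> still do. The remaining weighted terms are
  nonnegative and only help.\<close>

lemma suminf_powser_at_left_1:
  fixes q :: "nat \<Rightarrow> real"
  assumes q: "summable q" "\<And>n. 0 \<le> q n" and "0 < \<epsilon>"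
  obtains x where "0 < x" "x < 1" "(\<Sum>n. q n * (1 - x ^ n)) < \<epsilon>"
proof -
  obtain N where N: "(\<Sum>n. q n) - (\<Sum>n<N. q n) < \<epsilon>"
  proof -
    have "(\<lambda>N. \<Sum>n<N. q n) \<longlonglongrightarrow> (\<Sum>n. q n)" by (rule summable_LIMSEQ[OF q(1)])
    hence "eventually (\<lambda>N. (\<Sum>n. q n) - \<epsilon> < (\<Sum>n<N. q n)) sequentially"
      by (rule order_tendstoD) (use \<open>0 < \<epsilon>\<close> in auto)
    then obtain N where "(\<Sum>n. q n) - \<epsilon> < (\<Sum>n<N. q n)"
      by (auto simp: eventually_sequentially)
    thus ?thesis by (intro that[of N]) linarith
  qed
  have "((\<lambda>x. \<Sum>n<N. q n * x ^ n) \<longlongrightarrow> (\<Sum>n<N. q n * 1 ^ n)) (at_left (1::real))"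
    by (intro tendsto_intros)
  hence "eventually (\<lambda>x. (\<Sum>n. q n) - \<epsilon> < (\<Sum>n<N. q n * x ^ n)) (at_left 1)"
    by (rule order_tendstoD) (use N in auto)
  moreover have "eventually (\<lambda>x. x \<in> {0<..<1}) (at_left (1::real))"
    by (rule eventually_at_left_real) auto
  ultimately have "eventually (\<lambda>x. x \<in> {0<..<1} \<and> (\<Sum>n. q n) - \<epsilon> < (\<Sum>n<N. q n * x ^ n)) (at_left (1::real))"
    by eventually_elim auto
  then obtain x where x: "0 < x" "x < 1" "(\<Sum>n. q n) - \<epsilon> < (\<Sum>n<N. q n * x ^ n)"
    using eventually_happens[of _ "at_left (1::real)"] by auto
  have s: "summable (\<lambda>n. q n * x ^ n)"
    by (rule summable_comparison_test'[OF q(1), of 0])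
       (use x q(2) in \<open>auto simp: abs_mult intro!: mult_left_le power_le_one\<close>)
  have "(\<Sum>n. q n * (1 - x ^ n)) = (\<Sum>n. q n) - (\<Sum>n. q n * x ^ n)"
    by (simp add: right_diff_distrib suminf_diff[OF q(1) s])
  moreover have "(\<Sum>n<N. q n * x ^ n) \<le> (\<Sum>n. q n * x ^ n)"
    using x q(2) by (intro sum_le_suminf s) auto
  ultimately show ?thesis using x by (intro that[of x]) linarith+
qed

text \<open>Parseval controls the \<open>L\<^sup>2\<close> distance of two dilations uniformly in
  \<open>r\<close> and \<open>s\<close>. The conclusion is in \<open>L\<^sup>1\<close> because
  \<open>cauchy_L1_AE_cauchy_subseq\<close> extracts almost everywhere Cauchy subsequences from that
  form.\<close>

lemma dilations_L1_Cauchy: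
  assumes f: "f holomorphic_on ball 0 1" and B: "\<And>z. cmod z < 1 \<Longrightarrow> cmod (f z) \<le> B"
    and "0 < \<epsilon>"
  obtains x where "0 < x" "x < 1"
    "\<And>r s. x \<le> r \<Longrightarrow> r < 1 \<Longrightarrow> x \<le> s \<Longrightarrow> s < 1 \<Longrightarrow>
      (\<integral>\<xi>. cmod (f (of_real r * \<xi>) - f (of_real s * \<xi>)) \<partial>circle_measure) < \<epsilon>"
proof -
  define q where "q n = (cmod ((deriv ^^ n) f 0 / fact n))\<^sup>2" for n
  have q: "summable q" "\<And>n. 0 \<le> q n"
    using summable_coeff_square_bounded_holomorphic[OF f B] by (auto simp: q_def[abs_def])
  obtain x where x: "0 < x" "x < 1" "(\<Sum>n. q n * (1 - x ^ n)) < \<epsilon>\<^sup>2"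
    by (rule suminf_powser_at_left_1[OF q, of "\<epsilon>\<^sup>2"]) (use \<open>0 < \<epsilon>\<close> in auto)
  have "(\<integral>\<xi>. cmod (f (of_real r * \<xi>) - f (of_real s * \<xi>)) \<partial>circle_measure) < \<epsilon>"
    if rs: "x \<le> r" "r < 1" "x \<le> s" "s < 1" for r s
  proof -
    have p: "0 < r" "0 < s" using x rs by auto
    define h where "h \<xi> = f (of_real r * \<xi>) - f (of_real s * \<xi>)" for \<xi>
    have cont: "continuous_on (sphere 0 1) h"
      unfolding h_def using p rs
      by (intro continuous_intros continuous_on_subset[OF holomorphic_on_imp_continuous_on[OF holomorphic_dilation[OF f]]])
        (auto simp: field_simps)
    have S: "(\<lambda>n. q n * (r ^ n - s ^ n)\<^sup>2) sums (\<integral>\<xi>. (cmod (h \<xi>))\<^sup>2 \<partial>circle_measure)"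
      unfolding h_def q_def by (rule Parseval_dilation_diff[OF f]) (use p rs in auto)
    have sx: "summable (\<lambda>n. q n * (1 - x ^ n))"
      by (rule summable_comparison_test'[OF q(1), of 0])
         (use x q(2) in \<open>auto simp: abs_mult power_le_one intro!: mult_left_le\<close>)
    have "(\<integral>\<xi>. (cmod (h \<xi>))\<^sup>2 \<partial>circle_measure) \<le> (\<Sum>n. q n * (1 - x ^ n))"
    proof (subst sums_unique[OF S], rule suminf_le)
      fix n
      \<comment> \<open>Both powers lie in \<open>[x ^ n, 1]\<close>, so their distance is at most
        \<open>1 - x ^ n \<le> 1\<close>, and squaring a number in \<open>[0, 1]\<close> does not
        increase it. This removes \<open>r\<close> and \<open>s\<close> from the estimate.\<close>
      have "x ^ n \<le> r ^ n" "x ^ n \<le> s ^ n" "r ^ n \<le> 1" "s ^ n \<le> 1" "0 < x ^ n"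
        using x rs p by (auto intro!: power_mono power_le_one)
      hence "\<bar>r ^ n - s ^ n\<bar> \<le> 1 - x ^ n" "1 - x ^ n \<le> 1" by auto
      hence "(r ^ n - s ^ n)\<^sup>2 \<le> (1 - x ^ n) * 1"
        unfolding power2_eq_square abs_mult_self_eq[of "r ^ n - s ^ n", symmetric]
        by (intro mult_mono) auto
      thus "q n * (r ^ n - s ^ n)\<^sup>2 \<le> q n * (1 - x ^ n)"
        using q(2)[of n] by (intro mult_left_mono) auto
    qed (use S sx in \<open>auto simp: sums_iff\<close>)
    hence L2: "(\<integral>\<xi>. (cmod (h \<xi>))\<^sup>2 \<partial>circle_measure) < \<epsilon>\<^sup>2" using x(3) by simp
    have i2: "integrable circle_measure (\<lambda>\<xi>. (cmod (h \<xi>))\<^sup>2)"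
      and i1: "integrable circle_measure (\<lambda>\<xi>. cmod (h \<xi>))"
      by (intro integrable_circle_continuous continuous_intros cont)+
    \<comment> \<open>A pointwise arithmetic-geometric mean inequality in place of Cauchy-Schwarz,
      weighted so that the two terms add up to less than \<open>\<epsilon>\<close>.\<close>
    have "(\<integral>\<xi>. cmod (h \<xi>) \<partial>circle_measure) \<le> (\<integral>\<xi>. \<epsilon> / 2 + (cmod (h \<xi>))\<^sup>2 / (2 * \<epsilon>) \<partial>circle_measure)"
    proof (rule integral_mono[OF i1])
      show "integrable circle_measure (\<lambda>\<xi>. \<epsilon> / 2 + (cmod (h \<xi>))\<^sup>2 / (2 * \<epsilon>))"
        by (intro integrable_circle_continuous continuous_intros cont) (use \<open>0 < \<epsilon>\<close> in auto)
      fix \<xi>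
      have "2 * \<epsilon> * cmod (h \<xi>) \<le> \<epsilon>\<^sup>2 + (cmod (h \<xi>))\<^sup>2"
        by (rule sum_squares_bound)
      thus "cmod (h \<xi>) \<le> \<epsilon> / 2 + (cmod (h \<xi>))\<^sup>2 / (2 * \<epsilon>)"
        using \<open>0 < \<epsilon>\<close> by (simp add: field_simps power2_eq_square)
    qed
    also have "\<dots> = \<epsilon> / 2 + (\<integral>\<xi>. (cmod (h \<xi>))\<^sup>2 \<partial>circle_measure) / (2 * \<epsilon>)"
      using i2 integrable_circle_continuous[of "\<lambda>_. \<epsilon> / 2"] by (simp add: measure_circle)
    also have "\<dots> < \<epsilon> / 2 + \<epsilon>\<^sup>2 / (2 * \<epsilon>)"
      using L2 \<open>0 < \<epsilon>\<close> by (intro add_strict_left_mono divide_strict_right_mono) auto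
    also have "\<dots> = \<epsilon>" using \<open>0 < \<epsilon>\<close> by (simp add: power2_eq_square)
    finally show ?thesis by (simp add: h_def)
  qed
  thus ?thesis using x that by blast
qed

section \<open>Herglotz representation of bounded holomorphic functions\<close>

lemma Herglotz_kernel_bound:
  assumes "cmod z < 1" "cmod \<xi> = 1"
  shows "cmod ((\<xi> + z) / (\<xi> - z)) \<le> 2 / (1 - cmod z)"
proof -
  have "cmod (\<xi> + z) \<le> 2" using norm_triangle_ineq[of \<xi> z] assms by simp
  moreover have "1 - cmod z \<le> cmod (\<xi> - z)" using norm_triangle_ineq2[of \<xi> z] assms by simp
  ultimately show ?thesis using assms(1) by (simp add: norm_divide frac_le)
qed

lemma Herglotz_integrand_measurable:
  fixes U :: "complex \<Rightarrow> real"
  assumes z: "cmod z < 1" and [measurable]: "U \<in> borel_measurable circle_measure"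
  shows "(\<lambda>\<xi>. (\<xi> + z) / (\<xi> - z) * of_real (U \<xi>)) \<in> borel_measurable circle_measure"
proof -
  have [measurable]: "(\<lambda>\<xi>. (\<xi> + z) / (\<xi> - z)) \<in> borel_measurable circle_measure"
    using z by (intro borel_measurable_circle continuous_intros) auto
  show ?thesis by measurable
qed

text \<open>Each dilation satisfies the Schwarz formula, and dominated convergence carries it to the
  limit along a subsequence whose real parts converge almost everywhere. Real parts determine
  \<open>f\<close> only up to an imaginary constant, whence the term with
  \<open>Im (f 0)\<close>.\<close>

lemma bounded_holomorphic_Herglotz:
  assumes f: "f holomorphic_on ball 0 1" and B: "\<And>z. cmod z < 1 \<Longrightarrow> cmod (f z) \<le> B"
  obtains W :: "complex \<Rightarrow> real" where "W \<in> borel_measurable circle_measure" "\<And>\<xi>. \<bar>W \<xi>\<bar> \<le> B"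
    "\<And>z. cmod z < 1 \<Longrightarrow>
      (\<integral>\<xi>. (\<xi> + z) / (\<xi> - z) * of_real (W \<xi>) \<partial>circle_measure) = f z - \<i> * Im (f 0)"
proof -
  have B0: "0 \<le> B" using B[of 0] norm_ge_zero[of "f 0"] by (simp del: norm_ge_zero)
  \<comment> \<open>The shift by 2 gives \<open>r 0 = 1/2\<close>, so every dilation factor is
    positive.\<close>
  define r where "r i = 1 - inverse (real (i + 2))" for i
  have r: "0 < r i" "r i < 1" for i
    by (auto simp: r_def field_simps)
  have "(\<lambda>i. inverse (real (i + 2))) \<longlonglongrightarrow> 0"
    using LIMSEQ_ignore_initial_segment[OF lim_inverse_n, of 2] by simp
  hence r_lim: "r \<longlonglongrightarrow> 1"
    unfolding r_def using tendsto_diff[OF tendsto_const, of _ 0 sequentially "1::real"] by simp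
  define s where "s i \<xi> = f (of_real (r i) * \<xi>)" for i \<xi>
  have cont: "continuous_on (sphere 0 1) (s i)" for i
    unfolding s_def using r[of i]
    by (intro continuous_on_subset[OF holomorphic_on_imp_continuous_on[OF holomorphic_dilation[OF f r]]])
      (auto simp: field_simps)
  obtain p where p: "strict_mono p" "AE \<xi> in circle_measure. Cauchy (\<lambda>i. s (p i) \<xi>)"
  proof (rule cauchy_L1_AE_cauchy_subseq[of circle_measure s])
    show "integrable circle_measure (s n)" for n
      by (rule integrable_circle_continuous[OF cont])
    fix e :: real assume "0 < e"
    obtain x where x: "0 < x" "x < 1" 
      "\<And>r s. x \<le> r \<Longrightarrow> r < 1 \<Longrightarrow> x \<le> s \<Longrightarrow> s < 1 \<Longrightarrow>
        (\<integral>\<xi>. cmod (f (of_real r * \<xi>) - f (of_real s * \<xi>)) \<partial>circle_measure) < e"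
      using dilations_L1_Cauchy[OF f B \<open>0 < e\<close>] by metis
    obtain N where "\<And>i. i \<ge> N \<Longrightarrow> x < r i"
      using order_tendstoD(1)[OF r_lim x(2)] by (auto simp: eventually_sequentially)
    thus "\<exists>N. \<forall>i\<ge>N. \<forall>j\<ge>N. (\<integral>\<xi>. norm (s i \<xi> - s j \<xi>) \<partial>circle_measure) < e"
      unfolding s_def using x(3) r(2) by (intro exI[of _ N]) (auto simp: less_imp_le)
  qed
  \<comment> \<open>Where the sequence diverges, \<open>lim\<close> is arbitrary. Clamping forces
    the bound \<open>B\<close> everywhere, and changes nothing on the circle where the sequence
    converges, since its terms lie in \<open>[-B, B]\<close>.\<close>
  define clamp where "clamp x = max (- B) (min B x)" for x
  define W where "W \<xi> = clamp (lim (\<lambda>i. Re (s (p i) \<xi>)))" for \<xi>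
  have m: "(\<lambda>\<xi>. Re (s i \<xi>)) \<in> borel_measurable circle_measure" for i
    by (intro borel_measurable_circle continuous_intros cont)
  have Wm: "W \<in> borel_measurable circle_measure"
    unfolding W_def clamp_def by (intro borel_measurable_max borel_measurable_min
        borel_measurable_lim_metric m) auto
  have WB: "\<bar>W \<xi>\<bar> \<le> B" for \<xi>
    using B0 by (auto simp: W_def clamp_def)
  have sB: "\<bar>Re (s i \<xi>)\<bar> \<le> B" if "\<xi> \<in> sphere 0 1" for i \<xi>
  proof -
    have "cmod (of_real (r i) * \<xi>) < 1" using that r[of i] by (simp add: norm_mult)
    from B[OF this] show ?thesis unfolding s_def using abs_Re_le_cmod order_trans by blast
  qed
  have lim: "AE \<xi> in circle_measure. (\<lambda>i. Re (s (p i) \<xi>)) \<longlonglongrightarrow> W \<xi>"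
    using p(2) AE_space
  proof (eventually_elim, goal_cases)
    case (1 \<xi>)
    have "convergent (\<lambda>i. Re (s (p i) \<xi>))"
      using 1(1) by (intro Cauchy_convergent bounded_linear.Cauchy[OF bounded_linear_Re])
    hence "(\<lambda>i. Re (s (p i) \<xi>)) \<longlonglongrightarrow> lim (\<lambda>i. Re (s (p i) \<xi>))"
      by (simp add: convergent_LIMSEQ_iff)
    hence "(\<lambda>i. clamp (Re (s (p i) \<xi>))) \<longlonglongrightarrow> W \<xi>"
      unfolding W_def clamp_def by (intro tendsto_intros)
    moreover have "clamp (Re (s i \<xi>)) = Re (s i \<xi>)" for i
      using sB[of \<xi> i] 1(2) by (auto simp: clamp_def)
    ultimately show ?case by simp
  qed
  have "(\<integral>\<xi>. (\<xi> + z) / (\<xi> - z) * of_real (W \<xi>) \<partial>circle_measure) = f z - \<i> * Im (f 0)"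
    if z: "cmod z < 1" for z
  proof (rule LIMSEQ_unique)
    show "(\<lambda>i. \<integral>\<xi>. (\<xi> + z) / (\<xi> - z) * of_real (Re (s (p i) \<xi>)) \<partial>circle_measure)
       \<longlonglongrightarrow> (\<integral>\<xi>. (\<xi> + z) / (\<xi> - z) * of_real (W \<xi>) \<partial>circle_measure)"
    proof (rule integral_dominated_convergence)
      show "integrable circle_measure (\<lambda>_. 2 / (1 - cmod z) * B)"
        by (intro integrable_circle_continuous continuous_intros)
      show "AE \<xi> in circle_measure. (\<lambda>i. (\<xi> + z) / (\<xi> - z) * of_real (Re (s (p i) \<xi>)))
          \<longlonglongrightarrow> (\<xi> + z) / (\<xi> - z) * of_real (W \<xi>)"
        using lim by eventually_elim (intro tendsto_intros)
      show "AE \<xi> in circle_measure. norm ((\<xi> + z) / (\<xi> - z) * of_real (Re (s (p i) \<xi>)))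
          \<le> 2 / (1 - cmod z) * B" for i
      proof (rule AE_I2)
        fix \<xi> assume "\<xi> \<in> space circle_measure"
        thus "norm ((\<xi> + z) / (\<xi> - z) * of_real (Re (s (p i) \<xi>))) \<le> 2 / (1 - cmod z) * B"
          unfolding norm_mult using sB[of \<xi>] z Herglotz_kernel_bound[OF z, of \<xi>]
          by (intro mult_mono) auto
      qed
    qed (intro Herglotz_integrand_measurable z Wm m)+
    \<comment> \<open>Dilation fixes the origin, so the imaginary constant does not depend on
      \<open>i\<close>.\<close>
    have "(\<integral>\<xi>. (\<xi> + z) / (\<xi> - z) * of_real (Re (s i \<xi>)) \<partial>circle_measure)
        = s i z - \<i> * Im (f 0)" for i
      unfolding s_def using Schwarz_integral_formula[OF holomorphic_dilation[OF f r] _ z] r[of i]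
      by simp
    moreover have "(\<lambda>i. s (p i) z) \<longlonglongrightarrow> f z"
    proof -
      have "(\<lambda>i. of_real (r (p i)) * z) \<longlonglongrightarrow> of_real 1 * z"
        using LIMSEQ_subseq_LIMSEQ[OF r_lim p(1)] by (intro tendsto_intros) (simp add: o_def)
      moreover have "isCont f z"
        using holomorphic_on_imp_continuous_on[OF f] z
        by (simp add: continuous_on_eq_continuous_at)
      ultimately show ?thesis unfolding s_def using isCont_tendsto_compose[of z f] by simp
    qed
    ultimately show "(\<lambda>i. \<integral>\<xi>. (\<xi> + z) / (\<xi> - z) * of_real (Re (s (p i) \<xi>)) \<partial>circle_measure)
       \<longlonglongrightarrow> f z - \<i> * Im (f 0)"
      by (simp add: tendsto_diff)
  qed
  thus ?thesis using that Wm WB by blast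
qed

section \<open>Outer functions times exponentials of bounded functions\<close>

lemma integrable_on_circle_imp_integrable:
  assumes "integrable_on_circle W"
  shows "integrable circle_measure (\<lambda>\<xi>. real_of_ereal (W \<xi>))"
proof (rule integrableI_bounded)
  show "(\<lambda>\<xi>. real_of_ereal (W \<xi>)) \<in> borel_measurable circle_measure"
    using assms by (auto simp: integrable_on_circle_def)
  \<comment> \<open>At infinite \<open>x\<close> the left-hand side is 0, so only an inequality
    holds.\<close>
  have "ennreal (norm (real_of_ereal x)) \<le> e2ennreal \<bar>x\<bar>" for x
    by (cases x) auto
  hence "(\<integral>\<^sup>+ \<xi>. ennreal (norm (real_of_ereal (W \<xi>))) \<partial>circle_measure)
      \<le> (\<integral>\<^sup>+ \<xi>. e2ennreal \<bar>W \<xi>\<bar> \<partial>circle_measure)"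
    by (intro nn_integral_mono) auto
  also have "\<dots> < \<infinity>" using assms by (simp add: integrable_on_circle_def)
  finally show "(\<integral>\<^sup>+ \<xi>. ennreal (norm (real_of_ereal (W \<xi>))) \<partial>circle_measure) < \<infinity>" .
qed

lemma integrable_imp_integrable_on_circle:
  assumes "integrable circle_measure V"
  shows "integrable_on_circle (\<lambda>\<xi>. ereal (V \<xi>))"
  using assms unfolding integrable_on_circle_def integrable_iff_bounded
  by auto

text \<open>By the Herglotz representation \<open>exp (f z)\<close> is the unimodular constant
  \<open>exp (\<i> * Im (f 0))\<close> times an outer function with bounded boundary data
  \<open>V\<close>. The boundary data add, and the constant is absorbed into
  \<open>\<gamma>\<close>.\<close>

lemma outer_function_mult_exp:
  assumes phi: "outer_function \<phi>" and f: "f holomorphic_on ball 0 1"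
    and B: "\<And>z. cmod z < 1 \<Longrightarrow> cmod (f z) \<le> B"
  shows "outer_function (\<lambda>z. \<phi> z * exp (f z))"
proof -
  obtain \<gamma> W where W: "cmod \<gamma> = 1" "integrable_on_circle W" "\<And>z. cmod z < 1 \<Longrightarrow> \<phi> z =
     \<gamma> * exp (\<integral>\<xi>. (\<xi> + z) / (\<xi> - z) * of_real (real_of_ereal (W \<xi>)) \<partial>circle_measure)"
    using phi unfolding outer_function_def by auto
  obtain V :: "complex \<Rightarrow> real" where V: "V \<in> borel_measurable circle_measure" "\<And>\<xi>. \<bar>V \<xi>\<bar> \<le> B"
    "\<And>z. cmod z < 1 \<Longrightarrow>
      (\<integral>\<xi>. (\<xi> + z) / (\<xi> - z) * of_real (V \<xi>) \<partial>circle_measure) = f z - \<i> * Im (f 0)"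
    using bounded_holomorphic_Herglotz[OF f B] by metis
  have iV: "integrable circle_measure V"
    by (rule integrable_circle_bounded[OF V(1), of B]) (use V(2) in auto)
  note iW = integrable_on_circle_imp_integrable[OF W(2)]
  \<comment> \<open>For fixed \<open>z\<close> the kernel is bounded on the circle, so both
    integrands below are integrable and the integral is additive.\<close>
  have iK: "integrable circle_measure (\<lambda>\<xi>. (\<xi> + z) / (\<xi> - z) * of_real (U \<xi>))"
    if "cmod z < 1" "integrable circle_measure U" for z and U :: "complex \<Rightarrow> real"
  proof (rule Bochner_Integration.integrable_bound)
    show "integrable circle_measure (\<lambda>\<xi>. 2 / (1 - cmod z) * U \<xi>)"
      by (intro integrable_mult_right that)
    show "(\<lambda>\<xi>. (\<xi> + z) / (\<xi> - z) * of_real (U \<xi>)) \<in> borel_measurable circle_measure"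
      using that(2) by (intro Herglotz_integrand_measurable that borel_measurable_integrable)
    show "AE \<xi> in circle_measure. norm ((\<xi> + z) / (\<xi> - z) * of_real (U \<xi>))
      \<le> norm (2 / (1 - cmod z) * U \<xi>)"
    proof (rule AE_I2)
      fix \<xi> assume "\<xi> \<in> space circle_measure"
      thus "norm ((\<xi> + z) / (\<xi> - z) * of_real (U \<xi>)) \<le> norm (2 / (1 - cmod z) * U \<xi>)"
        unfolding norm_mult using Herglotz_kernel_bound[OF that(1), of \<xi>] that(1)
        by (intro mult_mono) auto
    qed
  qed
  \<comment> \<open>Infinite values of \<open>W\<close> count as 0, exactly as in the exponent of an
    outer function.\<close>
  define U where "U \<xi> = real_of_ereal (W \<xi>) + V \<xi>" for \<xi>
  define \<gamma>' where "\<gamma>' = \<gamma> * exp (\<i> * Im (f 0))"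
  have "\<phi> z * exp (f z) = \<gamma>' * exp (\<integral>\<xi>. (\<xi> + z) / (\<xi> - z) *
      of_real (real_of_ereal (ereal (U \<xi>))) \<partial>circle_measure)" if z: "z \<in> ball 0 1" for z
  proof -
    have z': "cmod z < 1" using z by simp
    have "(\<integral>\<xi>. (\<xi> + z) / (\<xi> - z) * of_real (real_of_ereal (ereal (U \<xi>))) \<partial>circle_measure)
      = (\<integral>\<xi>. (\<xi> + z) / (\<xi> - z) * of_real (real_of_ereal (W \<xi>))
           + (\<xi> + z) / (\<xi> - z) * of_real (V \<xi>) \<partial>circle_measure)"
      by (simp add: U_def distrib_left)
    also have "\<dots> = (\<integral>\<xi>. (\<xi> + z) / (\<xi> - z) * of_real (real_of_ereal (W \<xi>)) \<partial>circle_measure)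
        + (f z - \<i> * Im (f 0))"
      using V(3)[OF z'] by (subst Bochner_Integration.integral_add[OF iK[OF z' iW] iK[OF z' iV]]) simp
    finally show ?thesis
      by (simp add: W(3)[OF z'] \<gamma>'_def exp_add exp_diff)
  qed
  moreover have "cmod \<gamma>' = 1"
    using W(1) by (simp add: \<gamma>'_def norm_mult)
  moreover have "integrable_on_circle (\<lambda>\<xi>. ereal (U \<xi>))"
    unfolding U_def by (intro integrable_imp_integrable_on_circle Bochner_Integration.integrable_add iW iV)
  moreover have "(\<lambda>z. \<phi> z * exp (f z)) holomorphic_on ball 0 1"
    using phi unfolding outer_function_def by (intro holomorphic_intros f) auto
  ultimately show ?thesis
    unfolding outer_function_def by blast
qed

subsection \<open>Carleson's interpolation theorem\<close>

text \<open>Without the usual unimodular normalization, as only zeros, moduli and quotients of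
  values enter.\<close>

definition blaschke_factor :: "complex \<Rightarrow> complex \<Rightarrow> complex" where
  "blaschke_factor a z = (z - a) / (1 - cnj a * z)"

lemma one_minus_cnj_mult_nonzero:
  assumes "cmod a < 1" "cmod z < 1"
  shows "1 - cnj a * z \<noteq> 0"
proof
  assume "1 - cnj a * z = 0"
  hence "cmod (cnj a * z) = 1" by simp
  moreover have "cmod (cnj a * z) < 1 * 1"
    unfolding norm_mult using assms by (intro mult_strict_mono') auto
  ultimately show False by simp
qed

lemma cmod_one_minus_cnj_mult_squared:
  "(cmod (1 - cnj a * z))\<^sup>2 - (cmod (z - a))\<^sup>2 = (1 - (cmod a)\<^sup>2) * (1 - (cmod z)\<^sup>2)"
  unfolding cmod_power2 by (simp add: power2_eq_square algebra_simps)

lemma one_minus_blaschke_factor_squared: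
  assumes "cmod a < 1" "cmod z < 1"
  shows "1 - (cmod (blaschke_factor a z))\<^sup>2
    = (1 - (cmod a)\<^sup>2) * (1 - (cmod z)\<^sup>2) / (cmod (1 - cnj a * z))\<^sup>2"
  using one_minus_cnj_mult_nonzero[OF assms] cmod_one_minus_cnj_mult_squared[of a z]
  by (simp add: blaschke_factor_def norm_divide power_divide field_simps)

lemma one_minus_cmod_squared_pos: "0 < 1 - (cmod z)\<^sup>2" if "cmod z < 1"
  using that by (simp add: power_less_one_iff abs_square_less_1)

lemma cmod_blaschke_factor_le_1:
  assumes "cmod a < 1" "cmod z < 1"
  shows "cmod (blaschke_factor a z) \<le> 1"
proof -
  have "0 \<le> 1 - (cmod (blaschke_factor a z))\<^sup>2"
    unfolding one_minus_blaschke_factor_squared[OF assms]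
    using one_minus_cmod_squared_pos assms by (intro divide_nonneg_nonneg mult_nonneg_nonneg) (auto simp: less_imp_le)
  thus ?thesis by (simp add: abs_square_le_1)
qed

lemma Re_Herglotz_kernel:
  assumes "cmod a < 1" "cmod z < 1"
  shows "Re ((1 + cnj a * z) / (1 - cnj a * z)) = (1 - (cmod a * cmod z)\<^sup>2) / (cmod (1 - cnj a * z))\<^sup>2"
proof -
  have "Re ((1 + u) / (1 - u)) = (1 - (cmod u)\<^sup>2) / (cmod (1 - u))\<^sup>2" for u
    unfolding Re_divide cmod_power2 by (simp add: power2_eq_square algebra_simps)
  from this[of "cnj a * z"] show ?thesis by (simp add: norm_mult)
qed

text \<open>Each summand is \<open>1 - \<rho>\<^sup>2\<close> with \<open>\<rho>\<close> the modulus
  of a Blaschke factor. The term \<open>k = j\<close> is 1; for the others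
  \<open>1 - \<rho>\<^sup>2 \<le> - 2 * ln \<rho>\<close>, and the logarithms add up to that of the
  product.\<close>

lemma Carleson_sum_le:
  fixes \<Lambda> :: "'i \<Rightarrow> complex"
  assumes S: "finite S" "j \<in> S" and \<Lambda>: "\<And>k. k \<in> S \<Longrightarrow> cmod (\<Lambda> k) < 1"
    and \<delta>: "0 < \<delta>" "\<delta> \<le> (\<Prod>k\<in>S - {j}. cmod (blaschke_factor (\<Lambda> k) (\<Lambda> j)))"
  shows "(\<Sum>k\<in>S. (1 - (cmod (\<Lambda> k))\<^sup>2) * (1 - (cmod (\<Lambda> j))\<^sup>2) / (cmod (1 - cnj (\<Lambda> k) * \<Lambda> j))\<^sup>2)
    \<le> 1 - 2 * ln \<delta>"
proof -
  let ?\<rho> = "\<lambda>k. cmod (blaschke_factor (\<Lambda> k) (\<Lambda> j))"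
  have pos: "0 < ?\<rho> k" if "k \<in> S - {j}" for k
  proof -
    have "(\<Prod>k\<in>S - {j}. ?\<rho> k) \<noteq> 0" using \<delta> by linarith
    hence "?\<rho> k \<noteq> 0" using that S(1) by (simp add: prod_zero_iff)
    thus ?thesis by simp
  qed
  have "(\<Sum>k\<in>S. (1 - (cmod (\<Lambda> k))\<^sup>2) * (1 - (cmod (\<Lambda> j))\<^sup>2) / (cmod (1 - cnj (\<Lambda> k) * \<Lambda> j))\<^sup>2)
      = (\<Sum>k\<in>S. 1 - (?\<rho> k)\<^sup>2)"
    using S \<Lambda> by (intro sum.cong refl one_minus_blaschke_factor_squared[symmetric]) auto
  also have "\<dots> = 1 + (\<Sum>k\<in>S - {j}. 1 - (?\<rho> k)\<^sup>2)"
    using S by (simp add: sum.remove[of S j] blaschke_factor_def)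
  also have "(\<Sum>k\<in>S - {j}. 1 - (?\<rho> k)\<^sup>2) \<le> (\<Sum>k\<in>S - {j}. - 2 * ln (?\<rho> k))"
  proof (rule sum_mono)
    fix k assume k: "k \<in> S - {j}"
    have "ln ((?\<rho> k)\<^sup>2) \<le> (?\<rho> k)\<^sup>2 - 1"
      using pos[OF k] by (intro ln_le_minus_one) auto
    thus "1 - (?\<rho> k)\<^sup>2 \<le> - 2 * ln (?\<rho> k)"
      using pos[OF k] by (simp add: ln_realpow)
  qed
  also have "\<dots> = - 2 * ln (\<Prod>k\<in>S - {j}. ?\<rho> k)"
    using pos S(1) by (subst ln_prod) (auto simp: sum_distrib_left)
  also have "\<dots> \<le> - 2 * ln \<delta>"
  proof -
    have "ln \<delta> \<le> ln (\<Prod>k\<in>S - {j}. ?\<rho> k)"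
      using \<delta> by (subst ln_le_cancel_iff) auto
    thus ?thesis by simp
  qed
  finally show ?thesis by simp
qed

text \<open>A Riemann sum for the integral of \<open>exp (- x)\<close> over \<open>[0, \<Sum>k\<in>S. t k]\<close>; ties in \<open>r\<close> only
  decrease the left-hand side.\<close>

lemma sum_mult_exp_tail_le:
  fixes r t :: "'i \<Rightarrow> real"
  assumes "finite S" and t: "\<And>k. 0 \<le> t k"
  shows "(\<Sum>j\<in>S. t j * exp (- (\<Sum>k\<in>{k \<in> S. r j \<le> r k}. t k))) \<le> 1 - exp (- (\<Sum>k\<in>S. t k))"
  using assms(1)
\<comment> \<open>Ranking by \<open>- r\<close> inserts elements in order of non-increasing
  \<open>r\<close>, so the new \<open>x\<close> has the smallest value and its tail is all of
  \<open>insert x S\<close>.\<close>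
proof (induction S rule: finite_ranking_induct[where f = "\<lambda>k. - r k"])
  case empty
  show ?case by simp
next
  case (insert x S)
  show ?case
  proof (cases "x \<in> S")
    case True
    thus ?thesis using insert.IH by (simp add: insert_absorb)
  next
    case False
    have all: "{k \<in> insert x S. r x \<le> r k} = insert x S"
      using insert.hyps(2) by auto
    \<comment> \<open>The tail of an old \<open>j\<close> gains \<open>x\<close> only in a tie, and
      a larger tail makes the exponential smaller.\<close>
    have "(\<Sum>j\<in>S. t j * exp (- (\<Sum>k\<in>{k \<in> insert x S. r j \<le> r k}. t k)))
      \<le> (\<Sum>j\<in>S. t j * exp (- (\<Sum>k\<in>{k \<in> S. r j \<le> r k}. t k)))"
      using insert.hyps(1) t by (intro sum_mono mult_left_mono) (auto intro!: sum_mono2)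
    also note insert.IH
    finally have 1: "(\<Sum>j\<in>S. t j * exp (- (\<Sum>k\<in>{k \<in> insert x S. r j \<le> r k}. t k)))
      \<le> 1 - exp (- (\<Sum>k\<in>S. t k))" .
    \<comment> \<open>A rectangle of width \<open>t x\<close> under the graph of
      \<open>exp (- u)\<close>, with its height taken at the right end. Scaling by
      \<open>exp (- (\<Sum>k\<in>S. t k))\<close> moves it to the end of the interval.\<close>
    have "1 + t x \<le> exp (t x)" by (rule exp_ge_add_one_self)
    hence "t x * exp (- t x) \<le> 1 - exp (- t x)"
      by (simp add: exp_minus field_simps)
    hence "exp (- (\<Sum>k\<in>S. t k)) * (t x * exp (- t x)) \<le> exp (- (\<Sum>k\<in>S. t k)) * (1 - exp (- t x))"
      by (intro mult_left_mono) auto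
    hence 2: "t x * exp (- (\<Sum>k\<in>insert x S. t k))
        \<le> exp (- (\<Sum>k\<in>S. t k)) - exp (- (\<Sum>k\<in>insert x S. t k))"
      using False insert.hyps(1) by (simp add: exp_diff exp_minus field_simps)
    have "(\<Sum>j\<in>insert x S. t j * exp (- (\<Sum>k\<in>{k \<in> insert x S. r j \<le> r k}. t k)))
      = t x * exp (- (\<Sum>k\<in>insert x S. t k))
        + (\<Sum>j\<in>S. t j * exp (- (\<Sum>k\<in>{k \<in> insert x S. r j \<le> r k}. t k)))"
      by (subst sum.insert[OF insert.hyps(1) False]) (simp only: all)
    thus ?thesis using 1 2 by linarith
  qed
qed

text \<open>The real part of the exponent at \<open>z\<close> dominates the sum of the squared kernels of the nodes at
  least as far out as node \<open>j\<close>, so the exponential factor makes the sum over \<open>j\<close> of the moduli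
  bounded on the whole disk; at \<open>\<Lambda> j\<close> the exponents are bounded by \<open>Carleson_sum_le\<close>.\<close>

definition jones_exponent :: "('i \<Rightarrow> complex) \<Rightarrow> 'i set \<Rightarrow> 'i \<Rightarrow> complex \<Rightarrow> complex" where
  "jones_exponent \<Lambda> S j z = (\<Sum>k\<in>{k \<in> S. cmod (\<Lambda> j) \<le> cmod (\<Lambda> k)}.
     of_real (1 - (cmod (\<Lambda> k))\<^sup>2) * ((1 + cnj (\<Lambda> k) * z) / (1 - cnj (\<Lambda> k) * z)))"

text \<open>For distinct nodes in the disk, the product vanishes at every node except
  \<open>\<Lambda> j\<close>, and all three factors are 1 at \<open>\<Lambda> j\<close>. The middle
  factor is squared so that its modulus is the weight \<open>t j\<close> of
  \<open>jones_function_bound\<close>.\<close>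

definition jones_function :: "('i \<Rightarrow> complex) \<Rightarrow> 'i set \<Rightarrow> 'i \<Rightarrow> complex \<Rightarrow> complex" where
  "jones_function \<Lambda> S j z =
     (\<Prod>k\<in>S - {j}. blaschke_factor (\<Lambda> k) z / blaschke_factor (\<Lambda> k) (\<Lambda> j)) *
     (of_real (1 - (cmod (\<Lambda> j))\<^sup>2) / (1 - cnj (\<Lambda> j) * z))\<^sup>2 *
     exp (jones_exponent \<Lambda> S j (\<Lambda> j) - jones_exponent \<Lambda> S j z)"

section \<open>Values and bounds of Jones' functions\<close>

lemma jones_function_holomorphic:
  assumes S: "finite S" "j \<in> S" and \<Lambda>: "\<And>k. k \<in> S \<Longrightarrow> cmod (\<Lambda> k) < 1"
    and nz: "\<And>k. k \<in> S - {j} \<Longrightarrow> blaschke_factor (\<Lambda> k) (\<Lambda> j) \<noteq> 0"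
  shows "jones_function \<Lambda> S j holomorphic_on ball 0 1"
  unfolding jones_function_def[abs_def] jones_exponent_def blaschke_factor_def
  using S \<Lambda> nz[unfolded blaschke_factor_def] one_minus_cnj_mult_nonzero
  by (intro holomorphic_intros) auto

lemma jones_function_at_node:
  assumes S: "finite S" "j \<in> S" "i \<in> S" and \<Lambda>: "\<And>k. k \<in> S \<Longrightarrow> cmod (\<Lambda> k) < 1"
    and nz: "\<And>k. k \<in> S - {j} \<Longrightarrow> blaschke_factor (\<Lambda> k) (\<Lambda> j) \<noteq> 0"
  shows "jones_function \<Lambda> S j (\<Lambda> i) = (if i = j then 1 else 0)"
proof (cases "i = j")
  case True
  have "1 - cnj (\<Lambda> j) * \<Lambda> j \<noteq> 0"
    using one_minus_cnj_mult_nonzero \<Lambda> S(2) by blast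
  moreover have "of_real (1 - (cmod (\<Lambda> j))\<^sup>2) = 1 - cnj (\<Lambda> j) * \<Lambda> j"
    by (simp only: of_real_diff of_real_1 complex_norm_square mult.commute)
  moreover have "(\<Prod>k\<in>S - {j}. blaschke_factor (\<Lambda> k) (\<Lambda> j) / blaschke_factor (\<Lambda> k) (\<Lambda> j)) = 1"
    using nz by (intro prod.neutral) auto
  ultimately show ?thesis
    using True by (simp add: jones_function_def)
next
  case False
  hence "(\<Prod>k\<in>S - {j}. blaschke_factor (\<Lambda> k) (\<Lambda> i) / blaschke_factor (\<Lambda> k) (\<Lambda> j)) = 0"
    using S by (intro prod_zero) (auto simp: blaschke_factor_def)
  thus ?thesis using False by (simp add: jones_function_def)
qed

lemma Re_jones_exponent:
  assumes \<Lambda>: "\<And>k. k \<in> S \<Longrightarrow> cmod (\<Lambda> k) < 1" and z: "cmod z < 1"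
  shows "Re (jones_exponent \<Lambda> S j z) = (\<Sum>k\<in>{k \<in> S. cmod (\<Lambda> j) \<le> cmod (\<Lambda> k)}.
    (1 - (cmod (\<Lambda> k))\<^sup>2) * (1 - (cmod (\<Lambda> k) * cmod z)\<^sup>2) / (cmod (1 - cnj (\<Lambda> k) * z))\<^sup>2)"
proof -
  have *: "Re (complex_of_real c * ((1 + cnj a * z) / (1 - cnj a * z)))
      = c * (1 - (cmod a * cmod z)\<^sup>2) / (cmod (1 - cnj a * z))\<^sup>2" if "cmod a < 1" for c a
  proof -
    have "Re (complex_of_real c * ((1 + cnj a * z) / (1 - cnj a * z)))
        = c * Re ((1 + cnj a * z) / (1 - cnj a * z))"
      using times_complex.sel(1)[of "complex_of_real c"] by (simp only: Re_complex_of_real Im_complex_of_real mult_zero_left diff_zero)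
    thus ?thesis by (simp only: Re_Herglotz_kernel[OF that z] times_divide_eq_right)
  qed
  show ?thesis
    unfolding jones_exponent_def Re_sum using \<Lambda> by (intro sum.cong refl *) auto
qed

text \<open>Four estimates combine: the Blaschke quotients contribute at most
  \<open>1 / \<delta>\<close>, the middle factor exactly \<open>t j\<close>, the real part of the
  exponent is at most \<open>2 - 4 * ln \<delta>\<close> at \<open>\<Lambda> j\<close>, and at
  \<open>z\<close> it is at least the sum of the \<open>t k\<close>.\<close>

lemma jones_function_bound:
  assumes S: "finite S" "j \<in> S" and \<Lambda>: "\<And>k. k \<in> S \<Longrightarrow> cmod (\<Lambda> k) < 1" and z: "cmod z < 1"
    and \<delta>: "0 < \<delta>" "\<delta> \<le> (\<Prod>k\<in>S - {j}. cmod (blaschke_factor (\<Lambda> k) (\<Lambda> j)))"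
  defines "t \<equiv> (\<lambda>k. ((1 - (cmod (\<Lambda> k))\<^sup>2) / cmod (1 - cnj (\<Lambda> k) * z))\<^sup>2)"
  shows "cmod (jones_function \<Lambda> S j z) \<le> exp (2 - 4 * ln \<delta>) / \<delta> *
    (t j * exp (- (\<Sum>k\<in>{k \<in> S. cmod (\<Lambda> j) \<le> cmod (\<Lambda> k)}. t k)))"
proof -
  let ?T = "{k \<in> S. cmod (\<Lambda> j) \<le> cmod (\<Lambda> k)}"
  have pos: "0 < 1 - (cmod (\<Lambda> k))\<^sup>2" if "k \<in> S" for k
    using one_minus_cmod_squared_pos \<Lambda> that by blast
  have "(\<Prod>k\<in>S - {j}. cmod (blaschke_factor (\<Lambda> k) z)) \<le> 1"
    using \<Lambda> z by (intro prod_le_1) (auto intro: cmod_blaschke_factor_le_1)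
  hence 1: "cmod (\<Prod>k\<in>S - {j}. blaschke_factor (\<Lambda> k) z / blaschke_factor (\<Lambda> k) (\<Lambda> j)) \<le> 1 / \<delta>"
    using \<delta> by (auto simp: prod_norm[symmetric] norm_divide prod_dividef intro!: frac_le)
  have 2: "cmod ((of_real (1 - (cmod (\<Lambda> j))\<^sup>2) / (1 - cnj (\<Lambda> j) * z))\<^sup>2) = t j"
    using pos[OF S(2)] by (simp add: t_def norm_power norm_divide del: of_real_diff)
  have Re_exponent: "Re (jones_exponent \<Lambda> S j w) = (\<Sum>k\<in>?T.
      (1 - (cmod (\<Lambda> k))\<^sup>2) * (1 - (cmod (\<Lambda> k) * cmod w)\<^sup>2) / (cmod (1 - cnj (\<Lambda> k) * w))\<^sup>2)"
    if "cmod w < 1" for w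
    using Re_jones_exponent[of S \<Lambda> w j] \<Lambda> that by blast
  \<comment> \<open>Only nodes at least as far out as \<open>\<Lambda> j\<close> occur, so
    \<open>1 - (cmod (\<Lambda> k) * cmod (\<Lambda> j))\<^sup>2\<close> is at most
    \<open>1 - cmod (\<Lambda> j) ^ 4\<close>, hence at most twice
    \<open>1 - (cmod (\<Lambda> j))\<^sup>2\<close>. What remains is part of Carleson's sum.\<close>
  have "Re (jones_exponent \<Lambda> S j (\<Lambda> j)) \<le> (\<Sum>k\<in>?T. 2 * ((1 - (cmod (\<Lambda> k))\<^sup>2) * (1 - (cmod (\<Lambda> j))\<^sup>2)
      / (cmod (1 - cnj (\<Lambda> k) * \<Lambda> j))\<^sup>2))"
    unfolding Re_exponent[OF \<Lambda>[OF S(2)]]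
  proof (rule sum_mono)
    fix k assume k: "k \<in> ?T"
    hence "cmod (\<Lambda> j) * cmod (\<Lambda> j) \<le> cmod (\<Lambda> k) * cmod (\<Lambda> j)"
      by (intro mult_right_mono) auto
    hence "((cmod (\<Lambda> j))\<^sup>2)\<^sup>2 \<le> (cmod (\<Lambda> k) * cmod (\<Lambda> j))\<^sup>2"
      by (intro power_mono) (auto simp: power2_eq_square)
    moreover have "1 - x\<^sup>2 \<le> 2 * (1 - x)" for x :: real
      using zero_le_power2[of "1 - x"] by (simp add: power2_eq_square algebra_simps)
    ultimately have "1 - (cmod (\<Lambda> k) * cmod (\<Lambda> j))\<^sup>2 \<le> 2 * (1 - (cmod (\<Lambda> j))\<^sup>2)"
      by (smt (verit))
    hence "(1 - (cmod (\<Lambda> k))\<^sup>2) * (1 - (cmod (\<Lambda> k) * cmod (\<Lambda> j))\<^sup>2) / (cmod (1 - cnj (\<Lambda> k) * \<Lambda> j))\<^sup>2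
      \<le> (1 - (cmod (\<Lambda> k))\<^sup>2) * (2 * (1 - (cmod (\<Lambda> j))\<^sup>2)) / (cmod (1 - cnj (\<Lambda> k) * \<Lambda> j))\<^sup>2"
      using pos[of k] k by (intro divide_right_mono mult_left_mono) auto
    thus "(1 - (cmod (\<Lambda> k))\<^sup>2) * (1 - (cmod (\<Lambda> k) * cmod (\<Lambda> j))\<^sup>2) / (cmod (1 - cnj (\<Lambda> k) * \<Lambda> j))\<^sup>2
      \<le> 2 * ((1 - (cmod (\<Lambda> k))\<^sup>2) * (1 - (cmod (\<Lambda> j))\<^sup>2) / (cmod (1 - cnj (\<Lambda> k) * \<Lambda> j))\<^sup>2)"
      by (simp only: times_divide_eq_right mult_ac)
  qed
  also have "\<dots> = 2 * (\<Sum>k\<in>?T. (1 - (cmod (\<Lambda> k))\<^sup>2) * (1 - (cmod (\<Lambda> j))\<^sup>2)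
      / (cmod (1 - cnj (\<Lambda> k) * \<Lambda> j))\<^sup>2)"
    by (simp only: sum_distrib_left)
  also have "\<dots> \<le> 2 * (\<Sum>k\<in>S. (1 - (cmod (\<Lambda> k))\<^sup>2) * (1 - (cmod (\<Lambda> j))\<^sup>2)
      / (cmod (1 - cnj (\<Lambda> k) * \<Lambda> j))\<^sup>2)"
    using S pos by (intro mult_left_mono sum_mono2) (auto simp: less_imp_le)
  also have "\<dots> \<le> 2 * (1 - 2 * ln \<delta>)"
    using Carleson_sum_le[OF S \<Lambda> \<delta>] by simp
  finally have 3: "Re (jones_exponent \<Lambda> S j (\<Lambda> j)) \<le> 2 - 4 * ln \<delta>" by simp
  \<comment> \<open>As \<open>cmod z < 1\<close>, replacing \<open>cmod z\<close> by 1 in the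
    numerator only decreases each term, and leaves \<open>t k\<close>.\<close>
  have 4: "(\<Sum>k\<in>?T. t k) \<le> Re (jones_exponent \<Lambda> S j z)"
    unfolding Re_exponent[OF z]
  proof (rule sum_mono)
    fix k assume k: "k \<in> ?T"
    have "(cmod (\<Lambda> k) * cmod z)\<^sup>2 \<le> (cmod (\<Lambda> k) * 1)\<^sup>2"
      using z by (intro power_mono mult_left_mono) auto
    hence "(1 - (cmod (\<Lambda> k))\<^sup>2) * (1 - (cmod (\<Lambda> k))\<^sup>2) / (cmod (1 - cnj (\<Lambda> k) * z))\<^sup>2
        \<le> (1 - (cmod (\<Lambda> k))\<^sup>2) * (1 - (cmod (\<Lambda> k) * cmod z)\<^sup>2) / (cmod (1 - cnj (\<Lambda> k) * z))\<^sup>2"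
      using pos[of k] k by (intro divide_right_mono mult_left_mono) auto
    thus "t k \<le> (1 - (cmod (\<Lambda> k))\<^sup>2) * (1 - (cmod (\<Lambda> k) * cmod z)\<^sup>2) / (cmod (1 - cnj (\<Lambda> k) * z))\<^sup>2"
      by (simp add: t_def power_divide power2_eq_square)
  qed
  have "cmod (exp (jones_exponent \<Lambda> S j (\<Lambda> j) - jones_exponent \<Lambda> S j z))
      \<le> exp ((2 - 4 * ln \<delta>) + - (\<Sum>k\<in>?T. t k))"
    using 3 4 by simp
  hence 5: "cmod (exp (jones_exponent \<Lambda> S j (\<Lambda> j) - jones_exponent \<Lambda> S j z))
      \<le> exp (2 - 4 * ln \<delta>) * exp (- (\<Sum>k\<in>?T. t k))"
    by (simp only: exp_add)
  have "0 \<le> t j" by (simp add: t_def)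
  have "cmod (jones_function \<Lambda> S j z)
      \<le> 1 / \<delta> * t j * (exp (2 - 4 * ln \<delta>) * exp (- (\<Sum>k\<in>?T. t k)))"
    unfolding jones_function_def norm_mult 2
    using 1 5 \<open>0 \<le> t j\<close> \<delta>(1) by (intro mult_mono) auto
  thus ?thesis by (simp add: mult_ac)
qed

text \<open>Jones' functions are 1 at their own node and 0 at the others, so combining them with
  coefficients \<open>a j\<close> interpolates. The bound involves \<open>A\<close> and
  \<open>\<delta>\<close> but not the number of nodes, as the later compactness argument
  requires.\<close>

lemma finite_bounded_interpolation:
  fixes \<Lambda> :: "'i \<Rightarrow> complex"
  assumes S: "finite S" and \<Lambda>: "\<And>k. k \<in> S \<Longrightarrow> cmod (\<Lambda> k) < 1"
    and \<delta>: "0 < \<delta>" "\<And>j. j \<in> S \<Longrightarrow> \<delta> \<le> (\<Prod>k\<in>S - {j}. cmod (blaschke_factor (\<Lambda> k) (\<Lambda> j)))"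
    and a: "\<And>j. j \<in> S \<Longrightarrow> cmod (a j) \<le> A" "0 \<le> A"
  obtains f where "f holomorphic_on ball 0 1" "\<And>j. j \<in> S \<Longrightarrow> f (\<Lambda> j) = a j"
    "\<And>z. cmod z < 1 \<Longrightarrow> cmod (f z) \<le> A * (exp (2 - 4 * ln \<delta>) / \<delta>)"
proof
  define f where "f z = (\<Sum>j\<in>S. a j * jones_function \<Lambda> S j z)" for z
  have nz: "blaschke_factor (\<Lambda> k) (\<Lambda> j) \<noteq> 0" if "j \<in> S" "k \<in> S - {j}" for j k
  proof -
    have "(\<Prod>k\<in>S - {j}. cmod (blaschke_factor (\<Lambda> k) (\<Lambda> j))) \<noteq> 0"
      using \<delta>(1) \<delta>(2)[OF that(1)] by linarith
    thus ?thesis using S that(2) by (auto simp: prod_zero_iff)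
  qed
  show "f holomorphic_on ball 0 1"
    unfolding f_def by (intro holomorphic_intros jones_function_holomorphic S \<Lambda> nz)
  show "f (\<Lambda> j) = a j" if "j \<in> S" for j
  proof -
    have "jones_function \<Lambda> S i (\<Lambda> j) = (if j = i then 1 else 0)" if "i \<in> S" for i
      using jones_function_at_node[OF S \<open>i \<in> S\<close> \<open>j \<in> S\<close>] \<Lambda> nz[OF \<open>i \<in> S\<close>] by blast
    hence "f (\<Lambda> j) = (\<Sum>i\<in>S. if i = j then a j else 0)"
      unfolding f_def by (intro sum.cong refl) auto
    thus ?thesis using that S by simp
  qed
  show "cmod (f z) \<le> A * (exp (2 - 4 * ln \<delta>) / \<delta>)" if z: "cmod z < 1" for z
  proof -
    define C where "C = exp (2 - 4 * ln \<delta>) / \<delta>"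
    define t where "t k = ((1 - (cmod (\<Lambda> k))\<^sup>2) / cmod (1 - cnj (\<Lambda> k) * z))\<^sup>2" for k
    have C: "0 \<le> C" using \<delta>(1) by (simp add: C_def)
    have "cmod (f z) \<le> (\<Sum>j\<in>S. cmod (a j * jones_function \<Lambda> S j z))"
      unfolding f_def by (rule norm_sum)
    also have "\<dots> \<le> (\<Sum>j\<in>S. A * (C * (t j * exp (- (\<Sum>k\<in>{k \<in> S. cmod (\<Lambda> j) \<le> cmod (\<Lambda> k)}. t k)))))"
      unfolding norm_mult C_def t_def
      by (intro sum_mono mult_mono a jones_function_bound S \<Lambda> z \<delta>) auto
    also have "\<dots> = A * C * (\<Sum>j\<in>S. t j * exp (- (\<Sum>k\<in>{k \<in> S. cmod (\<Lambda> j) \<le> cmod (\<Lambda> k)}. t k)))"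
      by (simp add: sum_distrib_left mult_ac)
    also have "\<dots> \<le> A * C * 1"
    proof (rule mult_left_mono)
      \<comment> \<open>The moduli \<open>cmod (\<Lambda> k)\<close> play the role of
        \<open>r\<close> in \<open>sum_mult_exp_tail_le\<close>.\<close>
      have "(\<Sum>j\<in>S. t j * exp (- (\<Sum>k\<in>{k \<in> S. cmod (\<Lambda> j) \<le> cmod (\<Lambda> k)}. t k)))
          \<le> 1 - exp (- (\<Sum>k\<in>S. t k))"
        by (rule sum_mult_exp_tail_le[OF S]) (simp add: t_def)
      also have "\<dots> \<le> 1" by simp
      finally show "(\<Sum>j\<in>S. t j * exp (- (\<Sum>k\<in>{k \<in> S. cmod (\<Lambda> j) \<le> cmod (\<Lambda> k)}. t k))) \<le> 1" .
    qed (use C a(2) in auto)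
    finally show ?thesis by (simp add: C_def)
  qed
qed

section \<open>From finitely many nodes to the whole sequence\<close>

text \<open>Blaschke factors have modulus at most 1 on the disk, so the partial products decrease to
  their limit, which is at least the infimum over all nodes.\<close>

lemma separation_constant_le_partial_prod:
  assumes "interpolating_sequence \<Lambda>"
  shows "separation_constant \<Lambda> \<le> (\<Prod>k\<in>{..<N} - {n}. cmod (blaschke_factor (\<Lambda> k) (\<Lambda> n)))"
proof -
  have \<Lambda>: "cmod (\<Lambda> k) < 1" for k
  proof -
    have "\<Lambda> k \<in> ball 0 1" using assms unfolding interpolating_sequence_def by blast
    thus ?thesis by simp
  qed
  define P where "P n N = (\<Prod>k\<in>{..<N} - {n}. cmod (blaschke_factor (\<Lambda> k) (\<Lambda> n)))" for n N
  have P0: "0 \<le> P n N" for n N unfolding P_def by (intro prod_nonneg) auto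
  have dec: "decseq (P n)" for n
  proof (rule decseq_SucI)
    fix N
    show "P n (Suc N) \<le> P n N"
    proof (cases "N = n")
      case False
      hence "{..<Suc N} - {n} = insert N ({..<N} - {n})" by auto
      hence "P n (Suc N) = cmod (blaschke_factor (\<Lambda> N) (\<Lambda> n)) * P n N"
        by (simp add: P_def)
      also have "\<dots> \<le> 1 * P n N"
        by (intro mult_right_mono cmod_blaschke_factor_le_1 \<Lambda> P0)
      finally show ?thesis by simp
    next
      case True
      hence "{..<Suc N} - {n} = {..<N} - {n}" by auto
      thus ?thesis by (simp add: P_def)
    qed
  qed
  have lim: "P n \<longlonglongrightarrow> lim (P n)" for n
    using decseq_convergent[OF dec[of n], of 0] P0 by (metis limI)
  \<comment> \<open>The two differences have opposite signs, which the modulus hides.\<close>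
  have eq: "separation_constant \<Lambda> = (INF n. lim (P n))"
    unfolding separation_constant_def P_def blaschke_factor_def norm_divide
    by (simp only: norm_minus_commute)
  \<comment> \<open>Provides the lower bound that a real infimum needs in order to lie below its
    members.\<close>
  have "0 \<le> lim (P n)" for n
    using LIMSEQ_le_const[OF lim[of n], of 0] P0 by blast
  hence "separation_constant \<Lambda> \<le> lim (P n)"
    unfolding eq by (intro cINF_lower bdd_belowI[of _ 0]) auto
  also have "\<dots> \<le> P n N" by (rule decseq_ge[OF dec lim])
  finally show ?thesis by (simp add: P_def)
qed

text \<open>The solutions for the first \<open>N\<close> nodes share the bound \<open>B\<close>, so
  by Montel's theorem a subsequence converges pointwise on the disk to a holomorphic limit that
  keeps the bound and the prescribed values.\<close>

theorem Carleson_interpolation: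
  assumes \<Lambda>: "interpolating_sequence \<Lambda>" and a: "bounded (range a)"
  obtains f B where "f holomorphic_on ball 0 1" "\<And>n. f (\<Lambda> n) = a n"
    "\<And>z. cmod z < 1 \<Longrightarrow> cmod (f z) \<le> B"
proof -
  define \<delta> where "\<delta> = separation_constant \<Lambda>"
  have \<delta>: "0 < \<delta>" and "range \<Lambda> \<subseteq> ball 0 1"
    using \<Lambda> by (auto simp: interpolating_sequence_def \<delta>_def)
  hence disc: "cmod (\<Lambda> k) < 1" for k by (simp add: subset_iff)
  obtain A where A: "\<And>n. cmod (a n) \<le> A" "0 \<le> A"
    using a unfolding bounded_pos by (metis less_imp_le rangeI)
  define B where "B = A * (exp (2 - 4 * ln \<delta>) / \<delta>)"
  define \<H> where "\<H> = {h. h holomorphic_on ball 0 1 \<and> (\<forall>z. cmod z < 1 \<longrightarrow> cmod (h z) \<le> B)}"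
  have "\<exists>f. f \<in> \<H> \<and> (\<forall>j<N. f (\<Lambda> j) = a j)" for N
  proof -
    obtain f where "f holomorphic_on ball 0 1" "\<And>j. j \<in> {..<N} \<Longrightarrow> f (\<Lambda> j) = a j"
      "\<And>z. cmod z < 1 \<Longrightarrow> cmod (f z) \<le> A * (exp (2 - 4 * ln \<delta>) / \<delta>)"
      using finite_bounded_interpolation[of "{..<N}" \<Lambda> \<delta> a A] disc \<delta> A
        separation_constant_le_partial_prod[OF \<Lambda>, folded \<delta>_def]
      by (metis finite_lessThan)
    thus ?thesis unfolding \<H>_def B_def by blast
  qed
  then obtain F where F: "\<And>N. F N \<in> \<H>" "\<And>N j. j < N \<Longrightarrow> F N (\<Lambda> j) = a j"
    by metis
  obtain g r where g: "g holomorphic_on ball 0 1" and r: "strict_mono (r :: nat \<Rightarrow> nat)"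
    and lim: "\<And>x. x \<in> ball 0 1 \<Longrightarrow> (\<lambda>n. F (r n) x) \<longlonglongrightarrow> g x"
  proof (rule Montel[of "ball 0 1" \<H> F])
    fix K :: "complex set" assume "K \<subseteq> ball 0 1"
    thus "\<exists>B. \<forall>h\<in>\<H>. \<forall>z\<in>K. cmod (h z) \<le> B"
      by (intro exI[of _ B]) (auto simp: \<H>_def subset_iff)
  qed (use F in \<open>auto simp: \<H>_def\<close>)
  show ?thesis
  proof
    show "g holomorphic_on ball 0 1" by (rule g)
    show "g (\<Lambda> n) = a n" for n
    proof (rule LIMSEQ_unique)
      show "(\<lambda>i. F (r i) (\<Lambda> n)) \<longlonglongrightarrow> g (\<Lambda> n)" using lim disc by simp
      \<comment> \<open>For \<open>i > n\<close> also \<open>r i > n\<close>, so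
        \<open>F (r i)\<close> already has the right value at node \<open>n\<close>.\<close>
      have "eventually (\<lambda>i. F (r i) (\<Lambda> n) = a n) sequentially"
        using eventually_gt_at_top[of n]
      proof eventually_elim
        case (elim i)
        thus ?case using seq_suble[OF r, of i] by (intro F(2)) simp
      qed
      thus "(\<lambda>i. F (r i) (\<Lambda> n)) \<longlonglongrightarrow> a n" by (rule tendsto_eventually)
    qed
    show "cmod (g z) \<le> B" if "cmod z < 1" for z
    proof (rule LIMSEQ_le_const2)
      show "(\<lambda>i. cmod (F (r i) z)) \<longlonglongrightarrow> cmod (g z)"
        using lim[of z] that by (intro tendsto_norm) simp
      show "\<exists>N. \<forall>n\<ge>N. cmod (F (r n) z) \<le> B"
        using F(1) that by (auto simp: \<H>_def)
    qed
  qed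
qed

subsection \<open>Outer functions with prescribed values\<close>

text \<open>Boundedness is an implication about the same \<open>\<psi>\<close>, so one construction
  serves outer functions and bounded outer functions alike.\<close>

lemma outer_interpolation_transfer:
  assumes \<Lambda>: "interpolating_sequence \<Lambda>" and w: "\<And>n. w n \<noteq> 0"
    and m: "0 < m" "\<And>n. m \<le> cmod (w' n / w n)" "\<And>n. cmod (w' n / w n) \<le> M"
    and \<phi>: "outer_function \<phi>" "\<And>n. \<phi> (\<Lambda> n) = w n"
  obtains \<psi> where "outer_function \<psi>" "\<And>n. \<psi> (\<Lambda> n) = w' n"
    "bounded (\<phi> ` ball 0 1) \<Longrightarrow> bounded (\<psi> ` ball 0 1)"
proof -
  \<comment> \<open>With the principal logarithm the real parts lie between \<open>ln m\<close> and
    \<open>ln M\<close> and the imaginary parts have modulus at most \<open>pi\<close>, so the data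
    are bounded.\<close>
  define a where "a n = Ln (w' n / w n)" for n
  have nz: "w' n / w n \<noteq> 0" for n
    using m(1) m(2)[of n] by auto
  have "cmod (a n) \<le> max \<bar>ln m\<bar> \<bar>ln M\<bar> + pi" for n
  proof -
    have "ln m \<le> Re (a n)" "Re (a n) \<le> ln M"
      unfolding a_def Re_Ln[OF nz] using m(1) m(2,3)[of n] by (auto intro!: ln_mono simp del: norm_divide)
    moreover have "\<bar>Im (a n)\<bar> \<le> pi"
      unfolding a_def using mpi_less_Im_Ln[OF nz, of n] Im_Ln_le_pi[OF nz, of n] by simp
    ultimately show ?thesis
      using cmod_le[of "a n"] by linarith
  qed
  hence "bounded (range a)" by (auto intro: boundedI)
  then obtain f B where f: "f holomorphic_on ball 0 1" "\<And>n. f (\<Lambda> n) = a n"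
    and B: "\<And>z. cmod z < 1 \<Longrightarrow> cmod (f z) \<le> B"
    using Carleson_interpolation[OF \<Lambda>] by metis
  show ?thesis
  proof
    show "outer_function (\<lambda>z. \<phi> z * exp (f z))"
      by (rule outer_function_mult_exp[OF \<phi>(1) f(1) B])
    show "\<phi> (\<Lambda> n) * exp (f (\<Lambda> n)) = w' n" for n
      using w[of n] nz[of n] by (simp add: \<phi>(2) f(2) a_def)
    assume "bounded (\<phi> ` ball 0 1)"
    then obtain C where C: "\<And>z. cmod z < 1 \<Longrightarrow> cmod (\<phi> z) \<le> C" "0 < C"
      unfolding bounded_pos by (metis imageI mem_ball_0)
    have "cmod (\<phi> z * exp (f z)) \<le> C * exp B" if "cmod z < 1" for z
    proof -
      have "cmod (exp (f z)) \<le> exp B"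
        using complex_Re_le_cmod[of "f z"] B[OF that] by simp
      thus ?thesis
        unfolding norm_mult using C that by (intro mult_mono) auto
    qed
    thus "bounded ((\<lambda>z. \<phi> z * exp (f z)) ` ball 0 1)"
      by (auto intro!: boundedI)
  qed
qed

theorem proposition3p6:
  fixes \<Lambda> w w' :: "nat \<Rightarrow> complex" and m M :: real
  assumes "interpolating_sequence \<Lambda>"
    and "bounded (range w)" and "\<And>n. w n \<noteq> 0"
    and "bounded (range w')" and "\<And>n. w' n \<noteq> 0"
    and "0 < m" and "\<And>n. m \<le> cmod (w' n / w n)" and "\<And>n. cmod (w' n / w n) \<le> M"
  shows "((\<exists>\<phi>. outer_function \<phi> \<and> (\<forall>n. \<phi> (\<Lambda> n) = w n)) \<longleftrightarrow>
          (\<exists>\<phi>'. outer_function \<phi>' \<and> (\<forall>n. \<phi>' (\<Lambda> n) = w' n))) \<and>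
         ((\<exists>\<phi>. bounded_outer_function \<phi> \<and> (\<forall>n. \<phi> (\<Lambda> n) = w n)) \<longleftrightarrow>
          (\<exists>\<phi>'. bounded_outer_function \<phi>' \<and> (\<forall>n. \<phi>' (\<Lambda> n) = w' n)))"
proof -
  have M: "0 < M"
    using assms(6) assms(7,8)[of 0] by linarith
  \<comment> \<open>Exchanging \<open>w\<close> and \<open>w'\<close> inverts the quotients, so the
    converse directions use the constants \<open>1 / M\<close> and \<open>1 / m\<close>.\<close>
  have inv: "1 / M \<le> cmod (w n / w' n)" "cmod (w n / w' n) \<le> 1 / m" for n
  proof -
    have "cmod (w n / w' n) = 1 / cmod (w' n / w n)"
      by (simp add: norm_divide)
    thus "1 / M \<le> cmod (w n / w' n)" "cmod (w n / w' n) \<le> 1 / m"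
      using assms(6) assms(7,8)[of n] by (auto intro!: frac_le simp del: norm_divide)
  qed
  have M': "0 < 1 / M" using M by simp
  have "\<exists>\<psi>. outer_function \<psi> \<and> (\<forall>n. \<psi> (\<Lambda> n) = w' n) \<and>
      (bounded (\<phi> ` ball 0 1) \<longrightarrow> bounded (\<psi> ` ball 0 1))"
    if "outer_function \<phi>" "\<forall>n. \<phi> (\<Lambda> n) = w n" for \<phi>
    by (rule outer_interpolation_transfer[OF assms(1,3,6-8) that(1) that(2)[rule_format]]) blast
  moreover have "\<exists>\<psi>. outer_function \<psi> \<and> (\<forall>n. \<psi> (\<Lambda> n) = w n) \<and>
      (bounded (\<phi> ` ball 0 1) \<longrightarrow> bounded (\<psi> ` ball 0 1))"
    if "outer_function \<phi>" "\<forall>n. \<phi> (\<Lambda> n) = w' n" for \<phi>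
    by (rule outer_interpolation_transfer[OF assms(1,5) M' inv that(1) that(2)[rule_format]]) blast
  ultimately show ?thesis
    unfolding bounded_outer_function_def by blast
qed

end
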